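(* For every positive integer $n$, the average, over all $n!$ permutations $p$ of $\{1,2,\dots,n\}$, of the minimum number of block interchanges needed to sort $p$ (that is, to transform $p$ into the identity permutation $12\cdots n$) is $$b_n=\frac{1}{2}\left(n-\frac{1}{\lfloor n/2\rfloor+1}-\sum_{i=2}^{n}\frac{1}{i}\right).$$
   Context: A permutation of length $n$ is written in one-line notation $p=p_1p_2\cdots p_n$. A block interchange is an operation that interchanges two disjoint (not necessarily adjacent) blocks of consecutive entries without changing the order of entries within each block: for indices $1\le i\le i+a<j\le j+b\le n$ with $a,b\ge 0$, interchanging the blocks $p_ip_{i+1}\cdots p_{i+a}$ and $p_jp_{j+1}\cdots p_{j+b}$ results in $$p_1\cdots p_{i-1}\,p_j\cdots p_{j+b}\,p_{i+a+1}\cdots p_{j-1}\,p_i\cdots p_{i+a}\,p_{j+b+1}\cdots p_n.$$ For instance, interchanging the block of the first two entries with the block of the last three entries of $3417562$ gives $5621734$. The empty sum (when $n=1$) is $0$. *)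

theory Defs
  imports Complex_Main "HOL-Combinatorics.Multiset_Permutations"
begin

text \<open>
  Permutations of \<open>{1..n}\<close> in one-line notation are the lists in \<open>permutations_of_set {1..n}\<close>.
  In terms of indices, \<open>as\<close> is \<open>p\<^sub>i \<dots> p\<^bsub>i+a\<^esub>\<close> and \<open>bs\<close> is \<open>p\<^sub>j \<dots> p\<^bsub>j+b\<^esub>\<close>; both are nonempty
  since \<open>a, b \<ge> 0\<close>, while \<open>us\<close>, \<open>vs\<close> and \<open>ws\<close> may be empty.
\<close>

inductive block_interchange :: "'a list \<Rightarrow> 'a list \<Rightarrow> bool" where
  "as \<noteq> [] \<Longrightarrow> bs \<noteq> [] \<Longrightarrow>
     block_interchange (us @ as @ vs @ bs @ ws) (us @ bs @ vs @ as @ ws)"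

definition block_interchanges_to_sort :: "nat list \<Rightarrow> nat" where
  "block_interchanges_to_sort p =
     (LEAST k. (block_interchange ^^ k) p [1..<Suc (length p)])"

lemma "block_interchange [3, 4, 1, 7, 5, 6, 2 :: nat] [5, 6, 2, 1, 7, 3, 4]"
  using block_interchange.intros[of "[3, 4]" "[5, 6, 2 :: nat]" "[]" "[1, 7]" "[]"] by simp

end

theory Submission
  imports Defs "HOL-Combinatorics.Orbits"
begin

text \<open>
  Put \<open>c = (0 1 \<dots> n)\<close> and, for a permutation \<open>p\<close>, \<open>\<gamma> = (0 p\<^sub>1 \<dots> p\<^sub>n)\<close>. A block interchange multiplies \<open>\<gamma>\<close> by
  two crossing transpositions, so it changes the number of cycles of \<open>c\<^sup>-\<^sup>1 \<gamma>\<close> by at most two; as \<open>c\<close> is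
  transitive, some interchange gains two cycles unless \<open>\<gamma> = c\<close>. Hence (Christie) the sorting distance is
  half of \<open>n + 1\<close> minus the number of cycles of \<open>c\<^sup>-\<^sup>1 \<gamma>\<close>.

  On average over \<open>p\<close> this asks for the mean number of cycles of a product \<open>w\<close> of two long cycles on
  \<open>n + 1\<close> points. Inserting a further point into \<open>w\<close> at a random place keeps the number of cycles and
  yields, up to conjugation, a uniformly distributed odd permutation of \<open>n + 2\<close> points. This is proved
  for all class functions at once by induction on the number of points. The mean number of
  cycles of a random odd permutation is elementary.
\<close>

section \<open>Cycles and transpositions\<close>

definition ncycles :: "'a set \<Rightarrow> ('a \<Rightarrow> 'a) \<Rightarrow> nat" where
  "ncycles S p = card (orbit p ` S)"

lemma orbit_eq_of_mem:
  assumes "finite S" "p permutes S" "y \<in> orbit p x"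
  shows "orbit p y = orbit p x"
  using assms by (metis cyclic_on_alldef cyclic_on_orbit)

lemma self_in_orbit:
  assumes "finite S" "p permutes S"
  shows "x \<in> orbit p x"
  by (rule permutation_self_in_orbit[OF permutes_imp_permutation[OF assms]])

lemma in_orbit_sym:
  assumes "finite S" "p permutes S" "y \<in> orbit p x"
  shows "x \<in> orbit p y"
  using orbit_eq_of_mem[OF assms] self_in_orbit[OF assms(1,2)] by simp

lemma orbit_subset_closed:
  assumes "x \<in> A" "\<And>z. z \<in> A \<Longrightarrow> f z \<in> A"
  shows "orbit f x \<subseteq> A"
proof
  fix z assume "z \<in> orbit f x"
  then show "z \<in> A" by induction (use assms in auto)
qed

lemma permutes_comp_transpose:
  assumes "p permutes S" "x \<in> S" "y \<in> S"
  shows "p \<circ> transpose x y permutes S" "transpose x y \<circ> p permutes S"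
  using assms by (auto intro!: permutes_compose permutes_swap_id)

text \<open>The new permutation sends \<open>x\<close> to \<open>p y\<close> and then follows
  \<open>p\<close> along the cycle of \<open>y\<close>. That cycle never meets \<open>x\<close>, so
  nothing diverts the path before it reaches \<open>y\<close>.\<close>

lemma orbit_merge_aux:
  assumes fin: "finite S" and p: "p permutes S" and nin: "y \<notin> orbit p x"
  shows "orbit p y \<subseteq> orbit (p \<circ> transpose x y) x"
proof
  let ?q = "p \<circ> transpose x y"
  have start: "p y \<in> orbit ?q x"
    using orbit.base[of ?q x] by simp
  fix z assume "z \<in> orbit p y"
  then show "z \<in> orbit ?q x"
  proof induction
    case base
    show ?case by (fact start)
  next
    case (step z)
    have "z \<noteq> x" using step(1) nin in_orbit_sym[OF fin p] by blast
    then show ?case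
    proof (cases "z = y")
      case True then show ?thesis using start by (simp only:)
    next
      case False
      then show ?thesis using orbit.step[OF step.IH] \<open>z \<noteq> x\<close> by (metis comp_apply transpose_apply_other)
    qed
  qed
qed

text \<open>The union is closed under the new permutation, which bounds the orbit from above. For
  the other inclusion, \<open>orbit_merge_aux\<close> is used in both directions, the situation
  being symmetric in \<open>x\<close> and \<open>y\<close>.\<close>

lemma orbit_merge:
  assumes fin: "finite S" and p: "p permutes S" and S: "x \<in> S" "y \<in> S"
    and nin: "y \<notin> orbit p x"
  shows "orbit (p \<circ> transpose x y) x = orbit p x \<union> orbit p y"
proof
  let ?q = "p \<circ> transpose x y"
  have q: "?q permutes S" by (rule permutes_comp_transpose[OF p S])
  note self = self_in_orbit[OF fin p]
  show "orbit ?q x \<subseteq> orbit p x \<union> orbit p y"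
  proof (rule orbit_subset_closed)
    show "x \<in> orbit p x \<union> orbit p y" using self by simp
    fix z assume "z \<in> orbit p x \<union> orbit p y"
    then show "?q z \<in> orbit p x \<union> orbit p y"
      by (auto simp: Transposition.transpose_def intro: orbit.intros)
  qed
  have y: "orbit p y \<subseteq> orbit ?q x" by (rule orbit_merge_aux[OF fin p nin])
  have "x \<notin> orbit p y" using nin in_orbit_sym[OF fin p] by blast
  from orbit_merge_aux[OF fin p this] have "orbit p x \<subseteq> orbit ?q y"
    by (simp add: transpose_commute)
  moreover have "y \<in> orbit ?q x" using y self by blast
  then have "orbit ?q y = orbit ?q x" by (rule orbit_eq_of_mem[OF fin q])
  ultimately show "orbit p x \<union> orbit p y \<subseteq> orbit ?q x" using y by blast
qed

text \<open>Cycles avoiding \<open>x\<close> and \<open>y\<close> survive unchanged and form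
  \<open>?R\<close>; the two distinct cycles \<open>?X\<close> and \<open>?Y\<close> give way to
  their union.\<close>

lemma ncycles_merge:
  assumes fin: "finite S" and p: "p permutes S" and S: "x \<in> S" "y \<in> S"
    and nin: "y \<notin> orbit p x"
  shows "Suc (ncycles S (p \<circ> transpose x y)) = ncycles S p"
proof -
  let ?q = "p \<circ> transpose x y"
  let ?X = "orbit p x" and ?Y = "orbit p y"
  let ?R = "orbit p ` (S - (?X \<union> ?Y))"
  have q: "?q permutes S" by (rule permutes_comp_transpose[OF p S])
  note self = self_in_orbit[OF fin p]
  have XS: "?X \<subseteq> S" "?Y \<subseteq> S" using permutes_orbit_subset[OF p] S by auto
  have same: "orbit ?q z = orbit p z" if "z \<notin> ?X \<union> ?Y" for z
  proof (rule orbit_cong[OF self])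
    fix w assume w: "w \<in> orbit p z"
    have "w \<noteq> x" "w \<noteq> y" using that w in_orbit_sym[OF fin p w] by auto
    then show "?q w = p w" by simp
  qed
  have Rn: "?X \<notin> ?R" "?Y \<notin> ?R" "?X \<union> ?Y \<notin> ?R"
    using self by (blast, blast, blast)
  have neq: "?X \<noteq> ?Y" using nin self by blast
  have "orbit p ` S = insert ?X (insert ?Y ?R)"
  proof -
    have "S = (?X \<union> ?Y) \<union> (S - (?X \<union> ?Y))" using XS by blast
    then have "orbit p ` S = orbit p ` ?X \<union> orbit p ` ?Y \<union> ?R" by (metis image_Un)
    moreover have "orbit p ` ?X = {?X}" "orbit p ` ?Y = {?Y}"
      using orbit_eq_of_mem[OF fin p] self by (blast, blast)
    ultimately show ?thesis by auto
  qed
  then have 1: "ncycles S p = Suc (Suc (card ?R))"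
    unfolding ncycles_def using Rn neq fin by simp
  have "orbit ?q ` S = insert (?X \<union> ?Y) ?R"
  proof -
    have "S = (?X \<union> ?Y) \<union> (S - (?X \<union> ?Y))" using XS by blast
    then have "orbit ?q ` S = orbit ?q ` (?X \<union> ?Y) \<union> orbit ?q ` (S - (?X \<union> ?Y))"
      by (metis image_Un)
    moreover have "orbit ?q ` (S - (?X \<union> ?Y)) = ?R" using same by (intro image_cong) auto
    moreover have "orbit ?q z = ?X \<union> ?Y" if "z \<in> ?X \<union> ?Y" for z
      using orbit_eq_of_mem[OF fin q, of z x] orbit_merge[OF assms] that by simp
    then have "orbit ?q ` (?X \<union> ?Y) = {?X \<union> ?Y}" using self by blast
    ultimately show ?thesis by auto
  qed
  then have "ncycles S ?q = Suc (card ?R)"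
    unfolding ncycles_def using Rn fin by simp
  with 1 show ?thesis by simp
qed

text \<open>Let \<open>k\<close> be the first time at which \<open>p\<close> leads from
  \<open>y\<close> to \<open>x\<close>. The new permutation jumps from \<open>x\<close> to
  \<open>p y\<close> and walks on to \<open>(p ^^ k) y = x\<close>, closing up without passing
  through \<open>y\<close>.\<close>

lemma orbit_split:
  assumes fin: "finite S" and p: "p permutes S" and yin: "y \<in> orbit p x" and neq: "x \<noteq> y"
  shows "y \<notin> orbit (p \<circ> transpose x y) x"
proof -
  let ?q = "p \<circ> transpose x y"
  have "x \<in> orbit p y" by (rule in_orbit_sym[OF fin p yin])
  then obtain k0 where "k0 > 0" "(p ^^ k0) y = x" by (auto simp: orbit_altdef)
  define k where "k = (LEAST k. k > 0 \<and> (p ^^ k) y = x)"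
  have k: "k > 0" "(p ^^ k) y = x"
    using LeastI[of "\<lambda>k. k > 0 \<and> (p ^^ k) y = x" k0] \<open>k0 > 0\<close> \<open>(p ^^ k0) y = x\<close>
    unfolding k_def by auto
  have kmin: "(p ^^ i) y \<noteq> x" if "i > 0" "i < k" for i
    using not_less_Least[of i "\<lambda>k. k > 0 \<and> (p ^^ k) y = x"] that unfolding k_def by auto
  have noty: "(p ^^ i) y \<noteq> y" if "i > 0" "i \<le> k" for i
  proof
    assume e: "(p ^^ i) y = y"
    show False
    proof (cases "i = k")
      case True then show False using e k neq by simp
    next
      case False
      \<comment> \<open>An earlier return to \<open>y\<close> could be cut out of the path, reaching
        \<open>x\<close> before time \<open>k\<close>.\<close>
      have "(p ^^ k) y = (p ^^ (k - i)) ((p ^^ i) y)"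
        using that by (metis comp_apply funpow_add le_add_diff_inverse2)
      then have "(p ^^ (k - i)) y = x" using e k by simp
      then show False using kmin[of "k - i"] False that by simp
    qed
  qed
  let ?Z = "(\<lambda>i. (p ^^ i) y) ` {0<..k}"
  have "orbit ?q x \<subseteq> ?Z"
  proof (rule orbit_subset_closed)
    show "x \<in> ?Z" using k by (auto simp: image_iff)
    fix z assume "z \<in> ?Z"
    then obtain i where i: "0 < i" "i \<le> k" "z = (p ^^ i) y" by auto
    show "?q z \<in> ?Z"
    proof (cases "i = k")
      case True
      then have "z = x" using i k by simp
      then have "?q z = (p ^^ 1) y" by simp
      then show ?thesis using k(1) by (auto simp: image_iff intro!: bexI[of _ 1])
    next
      case False
      then have "z \<noteq> x" "z \<noteq> y" using i kmin noty by auto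
      then have "?q z = (p ^^ Suc i) y" using i by simp
      then show ?thesis using i False by (auto simp: image_iff intro!: bexI[of _ "Suc i"])
    qed
  qed
  moreover have "y \<notin> ?Z"
  proof
    assume "y \<in> ?Z"
    then obtain i where "0 < i" "i \<le> k" "(p ^^ i) y = y" by fastforce
    then show False using noty by blast
  qed
  ultimately show ?thesis by blast
qed

text \<open>Multiplying by the same transposition again restores \<open>p\<close>, and by
  \<open>orbit_split\<close> this second multiplication is a merge.\<close>

lemma ncycles_split:
  assumes fin: "finite S" and p: "p permutes S" and S: "x \<in> S" "y \<in> S"
    and yin: "y \<in> orbit p x" and neq: "x \<noteq> y"
  shows "ncycles S (p \<circ> transpose x y) = Suc (ncycles S p)"
proof -
  have "Suc (ncycles S ((p \<circ> transpose x y) \<circ> transpose x y)) = ncycles S (p \<circ> transpose x y)"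
    by (rule ncycles_merge[OF fin permutes_comp_transpose(1)[OF p S] S orbit_split[OF fin p yin neq]])
  then show ?thesis by (simp add: comp_assoc)
qed

lemma ncycles_comp_transpose_le:
  assumes "finite S" "p permutes S" "x \<in> S" "y \<in> S"
  shows "ncycles S (p \<circ> transpose x y) \<le> Suc (ncycles S p)"
proof (cases "x = y")
  case False
  then show ?thesis
    using ncycles_merge[OF assms] ncycles_split[OF assms] by fastforce
qed simp

section \<open>Cycle counts under conjugation, inversion and insertion of a point\<close>

lemma orbit_conj:
  assumes "bij r"
  shows "orbit (r \<circ> p \<circ> inv r) (r x) = r ` orbit p x"
proof -
  have "((r \<circ> p \<circ> inv r) ^^ n) (r x) = r ((p ^^ n) x)" for n
    using assms by (induction n) (simp_all add: bij_is_inj)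
  then show ?thesis by (auto simp: orbit_altdef)
qed

lemma ncycles_conj:
  assumes "r permutes S"
  shows "ncycles S (r \<circ> p \<circ> inv r) = ncycles S p"
proof -
  have bij: "bij r" by (rule permutes_bij[OF assms])
  have "orbit (r \<circ> p \<circ> inv r) ` S = orbit (r \<circ> p \<circ> inv r) ` (r ` S)"
    using permutes_image[OF assms] by simp
  also have "\<dots> = (`) r ` (orbit p ` S)" by (simp add: image_image orbit_conj[OF bij])
  finally have "orbit (r \<circ> p \<circ> inv r) ` S = (`) r ` (orbit p ` S)" .
  moreover have "inj_on ((`) r) (orbit p ` S)"
    by (simp add: inj_on_def inj_image_eq_iff[OF bij_is_inj[OF bij]])
  ultimately show ?thesis unfolding ncycles_def by (simp add: card_image)
qed

lemma ncycles_insert: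
  assumes "finite S" "p permutes S" "k \<notin> S"
  shows "ncycles (insert k S) p = Suc (ncycles S p)"
proof -
  have "p k = k" using assms by (simp add: permutes_not_in)
  then have "orbit p k = {k}" by (simp add: orbit_eq_singleton_iff)
  moreover have "{k} \<notin> orbit p ` S"
  proof
    assume "{k} \<in> orbit p ` S"
    then obtain x where "x \<in> S" "orbit p x = {k}" by auto
    then show False using self_in_orbit[OF assms(1,2), of x] assms(3) by simp
  qed
  ultimately show ?thesis using assms(1) by (simp add: ncycles_def)
qed

lemma ncycles_transpose_comp:
  assumes "p permutes S" "x \<in> S" "y \<in> S"
  shows "ncycles S (transpose x y \<circ> p) = ncycles S (p \<circ> transpose x y)"
  using ncycles_conj[OF permutes_swap_id[OF assms(2,3)], of "p \<circ> transpose x y"]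
  by (simp add: comp_assoc)

text \<open>The new point \<open>k\<close> is first a cycle of its own and is then merged into the
  cycle of \<open>a\<close>, so the gain and the loss cancel.\<close>

lemma ncycles_insert_transpose:
  assumes fin: "finite S" and p: "p permutes S" and k: "k \<notin> S" and a: "a \<in> S"
  shows "ncycles (insert k S) (transpose k a \<circ> p) = ncycles S p"
proof -
  have p': "p permutes insert k S" by (rule permutes_subset[OF p]) auto
  have "orbit p k = {k}" using p k by (simp add: permutes_not_in orbit_eq_singleton_iff)
  then have "a \<notin> orbit p k" using a k by auto
  then have "Suc (ncycles (insert k S) (p \<circ> transpose k a)) = ncycles (insert k S) p"
    using fin p' a by (intro ncycles_merge) auto
  then show ?thesis
    using ncycles_insert[OF fin p k] ncycles_transpose_comp[OF p', of k a] a by simp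
qed

lemma ncycles_inv:
  assumes "finite S" "p permutes S"
  shows "ncycles S (inv p) = ncycles S p"
  unfolding ncycles_def by (simp add: orbit_inv_eq[OF permutes_imp_permutation[OF assms]])

lemma ncycles_id: "ncycles S id = card S"
proof -
  have "orbit id ` S = (\<lambda>x. {x}) ` S"
    by (intro image_cong) (auto simp: orbit_eq_singleton_iff)
  then show ?thesis by (simp add: ncycles_def card_image)
qed

lemma ncycles_eq_1_iff:
  assumes "finite S" "p permutes S" "S \<noteq> {}"
  shows "ncycles S p = 1 \<longleftrightarrow> (\<forall>x\<in>S. \<forall>y\<in>S. y \<in> orbit p x)"
proof
  assume "ncycles S p = 1"
  then obtain X where X: "orbit p ` S = {X}" unfolding ncycles_def by (auto simp: card_1_singleton_iff)
  show "\<forall>x\<in>S. \<forall>y\<in>S. y \<in> orbit p x"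
  proof (intro ballI)
    fix x y assume "x \<in> S" "y \<in> S"
    then have "orbit p x = X" "orbit p y = X" using X by blast+
    then show "y \<in> orbit p x" using self_in_orbit[OF assms(1,2)] by metis
  qed
next
  assume *: "\<forall>x\<in>S. \<forall>y\<in>S. y \<in> orbit p x"
  obtain x where x: "x \<in> S" using assms by blast
  have "orbit p ` S = {orbit p x}" using * x orbit_eq_of_mem[OF assms(1,2)] by blast
  then show "ncycles S p = 1" by (simp add: ncycles_def)
qed

section \<open>Products of two long cycles\<close>

definition long_cycles :: "nat \<Rightarrow> (nat \<Rightarrow> nat) set" where
  "long_cycles N = {p. p permutes {..<N} \<and> ncycles {..<N} p = 1}"

lemma finite_long_cycles [simp]: "finite (long_cycles N)"
  unfolding long_cycles_def by (rule finite_subset[OF _ finite_permutations[of "{..<N}"]]) auto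

lemma long_cycles_permutes: "p \<in> long_cycles N \<Longrightarrow> p permutes {..<N}"
  by (simp add: long_cycles_def)

lemma long_cycles_conj:
  assumes "r permutes {..<N}" "p \<in> long_cycles N"
  shows "r \<circ> p \<circ> inv r \<in> long_cycles N"
  using assms by (auto simp: long_cycles_def ncycles_conj intro!: permutes_compose permutes_inv)

lemma long_cycles_inv:
  assumes "p \<in> long_cycles N"
  shows "inv p \<in> long_cycles N"
  using assms by (auto simp: long_cycles_def ncycles_inv intro!: permutes_inv)

lemma sum_long_cycles_conj:
  assumes "r permutes {..<N}"
  shows "(\<Sum>z\<in>long_cycles N. f (r \<circ> z \<circ> inv r)) = (\<Sum>z\<in>long_cycles N. f z)"
proof (rule sum.reindex_bij_witness[where i = "\<lambda>z. inv r \<circ> z \<circ> r" and j = "\<lambda>z. r \<circ> z \<circ> inv r"])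
  fix z assume z: "z \<in> long_cycles N"
  show "r \<circ> z \<circ> inv r \<in> long_cycles N" by (rule long_cycles_conj[OF assms z])
  show "inv r \<circ> z \<circ> r \<in> long_cycles N"
    using long_cycles_conj[OF permutes_inv[OF assms] z] by (simp add: permutes_inv_inv[OF assms])
  show "inv r \<circ> (r \<circ> z \<circ> inv r) \<circ> r = z" "r \<circ> (inv r \<circ> z \<circ> r) \<circ> inv r = z"
    by (simp_all add: fun_eq_iff permutes_inverses[OF assms])
qed simp

lemma sum_long_cycles_inv:
  "(\<Sum>z\<in>long_cycles N. f (inv z)) = (\<Sum>z\<in>long_cycles N. f z)"
  by (rule sum.reindex_bij_witness[where i = inv and j = inv])
    (auto simp: long_cycles_inv permutes_inv_inv[OF long_cycles_permutes])

text \<open>Multiplying by \<open>transpose N a\<close> inserts \<open>N\<close> into the cycle of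
  \<open>a\<close>, which keeps the number of cycles.\<close>

lemma transpose_comp_long_cycle:
  assumes "a < N" "c permutes {..<N}"
  shows "transpose N a \<circ> c \<in> long_cycles (Suc N) \<longleftrightarrow> c \<in> long_cycles N"
proof -
  have "c permutes {..<Suc N}" by (rule permutes_subset[OF assms(2)]) auto
  then have "transpose N a \<circ> c permutes {..<Suc N}"
    using assms(1) by (intro permutes_comp_transpose) auto
  then show ?thesis
    using ncycles_insert_transpose[OF _ assms(2), of N a] assms
    by (auto simp: long_cycles_def lessThan_Suc)
qed

lemma long_cycle_moves:
  assumes "p \<in> long_cycles N" "N \<ge> 2" "x < N"
  shows "p x \<noteq> x"
proof
  assume "p x = x"
  then have "orbit p x = {x}" by (simp add: orbit_eq_singleton_iff)
  moreover have "\<forall>x\<in>{..<N}. \<forall>y\<in>{..<N}. y \<in> orbit p x"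
    using assms by (subst ncycles_eq_1_iff[symmetric]) (auto simp: long_cycles_def lessThan_empty_iff)
  ultimately have "\<forall>y<N. y = x" using assms(3) by auto
  from this[rule_format, of 0] this[rule_format, of 1] assms(2) show False by simp
qed

text \<open>Deleting the point \<open>N\<close> from a long cycle \<open>z\<close> leaves a long
  cycle on the remaining points, and \<open>a = z N\<close> records where \<open>N\<close> was. Here
  \<open>N \<ge> 1\<close> guarantees that \<open>z\<close> moves \<open>N\<close>.\<close>

lemma sum_long_cycles_Suc_left:
  assumes "N \<ge> 1"
  shows "(\<Sum>z\<in>long_cycles (Suc N). f z) =
    (\<Sum>c\<in>long_cycles N. \<Sum>a<N. f (transpose N a \<circ> c))"
proof -
  have "(\<Sum>c\<in>long_cycles N. \<Sum>a<N. f (transpose N a \<circ> c)) =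
      (\<Sum>(c, a)\<in>long_cycles N \<times> {..<N}. f (transpose N a \<circ> c))"
    by (rule sum.cartesian_product)
  also have "\<dots> = (\<Sum>z\<in>long_cycles (Suc N). f z)"
  proof (rule sum.reindex_bij_witness[where
        j = "\<lambda>(c, a). transpose N a \<circ> c" and i = "\<lambda>z. (transpose N (z N) \<circ> z, z N)"])
    fix ca assume "ca \<in> long_cycles N \<times> {..<N}"
    then obtain c a where ca: "ca = (c, a)" "c \<in> long_cycles N" "a < N" by auto
    note c = long_cycles_permutes[OF ca(2)]
    have cN: "c N = N" using c by (simp add: permutes_not_in)
    show "(\<lambda>z. (transpose N (z N) \<circ> z, z N)) ((\<lambda>(c, a). transpose N a \<circ> c) ca) = ca"
      using ca cN by (simp add: fun_eq_iff)
    show "(\<lambda>(c, a). transpose N a \<circ> c) ca \<in> long_cycles (Suc N)"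
      using ca transpose_comp_long_cycle[OF ca(3) c] by simp
    show "f ((\<lambda>(c, a). transpose N a \<circ> c) ca) = (\<lambda>(c, a). f (transpose N a \<circ> c)) ca"
      using ca by simp
  next
    fix z assume z: "z \<in> long_cycles (Suc N)"
    note pz = long_cycles_permutes[OF z]
    have "z N \<noteq> N" using long_cycle_moves[OF z, of N] assms by simp
    moreover have "z N < Suc N" using pz permutes_in_image[of z "{..<Suc N}" N] by simp
    ultimately have zN: "z N < N" by simp
    let ?c = "transpose N (z N) \<circ> z"
    have "?c permutes {..<Suc N}" using pz zN by (intro permutes_comp_transpose) auto
    then have c: "?c permutes {..<N}" by (rule permutes_superset) (auto simp: less_Suc_eq)
    have eq: "transpose N (z N) \<circ> ?c = z" by (simp add: fun_eq_iff)
    have "?c \<in> long_cycles N"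
      using transpose_comp_long_cycle[OF zN c] z unfolding eq by simp
    then show "(?c, z N) \<in> long_cycles N \<times> {..<N}" using zN by simp
    show "(\<lambda>(c, a). transpose N a \<circ> c) (?c, z N) = z" using eq by simp
  qed
  finally show ?thesis by simp
qed

text \<open>Inversion permutes the long cycles and turns the left factor
  \<open>transpose N a\<close> into a right factor.\<close>

lemma sum_long_cycles_Suc_right:
  assumes "N \<ge> 1"
  shows "(\<Sum>z\<in>long_cycles (Suc N). f z) =
    (\<Sum>c\<in>long_cycles N. \<Sum>a<N. f (c \<circ> transpose N a))"
proof -
  have "(\<Sum>z\<in>long_cycles (Suc N). f z) =
      (\<Sum>c\<in>long_cycles N. \<Sum>a<N. f (inv (transpose N a \<circ> c)))"
    using sum_long_cycles_Suc_left[OF assms, of "\<lambda>z. f (inv z)"] sum_long_cycles_inv[of f "Suc N"]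
    by simp
  also have "\<dots> = (\<Sum>c\<in>long_cycles N. \<Sum>a<N. f (inv c \<circ> transpose N a))"
    by (intro sum.cong refl) (simp add: o_inv_distrib permutes_bij[OF long_cycles_permutes])
  also have "\<dots> = (\<Sum>c\<in>long_cycles N. \<Sum>a<N. f (c \<circ> transpose N a))"
    by (rule sum_long_cycles_inv)
  finally show ?thesis .
qed

lemma long_cycles_1: "long_cycles (Suc 0) = {id}"
  unfolding long_cycles_def by (auto simp: lessThan_Suc ncycles_id)

lemma card_long_cycles: "N \<ge> 1 \<Longrightarrow> card (long_cycles N) = fact (N - 1)"
proof (induction N rule: nat_induct_at_least)
  case base
  show ?case by (simp add: long_cycles_1)
next
  case (Suc N)
  have "card (long_cycles (Suc N)) = (\<Sum>c\<in>long_cycles N. \<Sum>a<N. 1)"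
    using sum_long_cycles_Suc_left[OF Suc.hyps, of "\<lambda>_. 1 :: nat"] by simp
  also have "\<dots> = fact (N - 1) * N" using Suc by simp
  also have "\<dots> = fact N" using Suc.hyps by (simp add: fact_reduce)
  finally show ?case by simp
qed

section \<open>Class functions and exchanging two inserted points\<close>

definition class_function :: "'a set \<Rightarrow> (('a \<Rightarrow> 'a) \<Rightarrow> real) \<Rightarrow> bool" where
  "class_function S \<phi> \<longleftrightarrow>
     (\<forall>r p. r permutes S \<longrightarrow> p permutes S \<longrightarrow> \<phi> (r \<circ> p \<circ> inv r) = \<phi> p)"

lemma class_functionD:
  "class_function S \<phi> \<Longrightarrow> r permutes S \<Longrightarrow> p permutes S \<Longrightarrow> \<phi> (r \<circ> p \<circ> inv r) = \<phi> p"
  by (simp add: class_function_def)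

lemma class_function_commute:
  assumes "class_function S \<phi>" "p permutes S" "q permutes S"
  shows "\<phi> (p \<circ> q) = \<phi> (q \<circ> p)"
proof -
  have "p \<circ> (q \<circ> p) \<circ> inv p = p \<circ> q"
    by (simp add: fun_eq_iff permutes_inverses[OF assms(2)])
  then show ?thesis
    using class_functionD[OF assms(1,2) permutes_compose[OF assms(2,3)]] by simp
qed

lemma class_function_subset:
  assumes "class_function S \<phi>" "R \<subseteq> S"
  shows "class_function R \<phi>"
  unfolding class_function_def
  by (intro allI impI class_functionD[OF assms(1)]) (erule permutes_subset[OF _ assms(2)])+

abbreviation T :: "nat \<Rightarrow> nat \<Rightarrow> nat \<Rightarrow> nat" where "T \<equiv> Transposition.transpose"

lemma permutes_comp_commute_transpose:
  assumes "w permutes S" "j \<notin> S" "k \<notin> S"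
  shows "w \<circ> transpose j k = transpose j k \<circ> w"
proof
  fix x
  have "w x \<in> S \<longleftrightarrow> x \<in> S" by (rule permutes_in_image[OF assms(1)])
  then show "(w \<circ> transpose j k) x = (transpose j k \<circ> w) x"
    using assms permutes_not_in[OF assms(1)]
    by (cases "x \<in> S") (auto simp: Transposition.transpose_def)
qed

text \<open>
  Conjugation by the transposition of the two new points \<open>N\<close> and \<open>Suc N\<close> turns the left factor
  \<open>T N a\<close> into \<open>T (Suc N) a\<close>; the map \<open>(a', b) \<mapsto> (a1, b1)\<close> is an involution.
\<close>

lemma transposition_triple_exchange:
  assumes "a < N" "a' < N" "b < Suc N" and w: "w permutes {..<N}"
  defines "b1 \<equiv> if b = N then a' else if b = a' then N else a'"
    and "a1 \<equiv> if b = N \<or> b = a' then a' else b"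
  shows "T N (Suc N) \<circ> (T N a \<circ> T (Suc N) b \<circ> T N a' \<circ> w) \<circ> inv (T N (Suc N)) =
    T (Suc N) a \<circ> T (Suc N) b1 \<circ> T N a1 \<circ> w"
proof -
  let ?t = "T N (Suc N)"
  have conjN: "?t \<circ> T N x \<circ> ?t = T (Suc N) x" if "x < N" for x
    using that by (simp add: fun_eq_iff Transposition.transpose_def)
  have conjS: "?t \<circ> T (Suc N) b \<circ> ?t = (if b = N then ?t else T N b)"
    using assms(3) by (simp add: fun_eq_iff Transposition.transpose_def)
  have "?t \<circ> (T N a \<circ> T (Suc N) b \<circ> T N a' \<circ> w) \<circ> inv ?t =
      (?t \<circ> T N a \<circ> T (Suc N) b \<circ> T N a') \<circ> (w \<circ> ?t)"
    by (simp add: comp_assoc)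
  also have "w \<circ> ?t = ?t \<circ> w"
    by (rule permutes_comp_commute_transpose[OF w]) auto
  \<comment> \<open>Writing the identity as \<open>?t \<circ> ?t\<close> between neighbouring
    factors lets the conjugation act on each transposition separately.\<close>
  also have "(?t \<circ> T N a \<circ> T (Suc N) b \<circ> T N a') \<circ> (?t \<circ> w) =
      (?t \<circ> T N a \<circ> ?t) \<circ> ((?t \<circ> T (Suc N) b \<circ> ?t) \<circ> (?t \<circ> T N a' \<circ> ?t)) \<circ> w"
    by (simp add: fun_eq_iff)
  also have "\<dots> = T (Suc N) a \<circ> ((if b = N then ?t else T N b) \<circ> T (Suc N) a') \<circ> w"
    by (simp only: conjN[OF assms(1)] conjN[OF assms(2)] conjS)
  also have "(if b = N then ?t else T N b) \<circ> T (Suc N) a' = T (Suc N) b1 \<circ> T N a1"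
  proof -
    consider "b = N" | "b = a'" | "b < N" "b \<noteq> a'" using assms(3) by linarith
    then show ?thesis
      unfolding b1_def a1_def
      by cases (use assms(2) in \<open>simp_all add: fun_eq_iff Transposition.transpose_def\<close>)
  qed
  finally show ?thesis by (simp only: comp_assoc)
qed

text \<open>Each summand on the left equals the one on the right at the image of
  \<open>(a', b)\<close> under the involution, because the two arguments of \<open>\<phi>\<close>
  are conjugate. The index \<open>a\<close> stays fixed.\<close>

lemma sum_transposition_triple_exchange:
  assumes w: "w permutes {..<N}" and \<phi>: "class_function {..<Suc (Suc N)} \<phi>" and a: "a < N"
  shows "(\<Sum>a'<N. \<Sum>b<Suc N. \<phi> (T N a \<circ> T (Suc N) b \<circ> T N a' \<circ> w)) =
    (\<Sum>a'<N. \<Sum>b<Suc N. \<phi> (T (Suc N) a \<circ> T (Suc N) b \<circ> T N a' \<circ> w))"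
  unfolding sum.cartesian_product
proof (rule sum.reindex_bij_witness[where
      i = "\<lambda>(a', b). (if b = N \<or> b = a' then a' else b, if b = N then a' else if b = a' then N else a')"
      and j = "\<lambda>(a', b). (if b = N \<or> b = a' then a' else b, if b = N then a' else if b = a' then N else a')"])
  fix x assume "x \<in> {..<N} \<times> {..<Suc N}"
  then obtain a' b where x: "x = (a', b)" "a' < N" "b < Suc N" by auto
  have w': "w permutes {..<Suc (Suc N)}" by (rule permutes_subset[OF w]) auto
  have p: "T N a \<circ> T (Suc N) b \<circ> T N a' \<circ> w permutes {..<Suc (Suc N)}"
    using x a w' by (intro permutes_compose permutes_swap_id) auto
  have "T N (Suc N) permutes {..<Suc (Suc N)}" by (intro permutes_swap_id) auto
  from class_functionD[OF \<phi> this p] transposition_triple_exchange[OF a x(2,3) w]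
  show "(\<lambda>(a', b). \<phi> (T (Suc N) a \<circ> T (Suc N) b \<circ> T N a' \<circ> w))
      ((\<lambda>(a', b). (if b = N \<or> b = a' then a' else b, if b = N then a' else if b = a' then N else a')) x) =
      (\<lambda>(a', b). \<phi> (T N a \<circ> T (Suc N) b \<circ> T N a' \<circ> w)) x"
    using x by simp
qed (auto split: if_splits)

text \<open>Since \<open>r\<close> fixes the new point \<open>M\<close>, conjugation by it turns
  \<open>T M a\<close> into \<open>T M (r a)\<close>; the double sum only has its indices
  permuted.\<close>

lemma class_function_double_insertion:
  assumes \<phi>: "class_function {..<Suc M} \<phi>"
  shows "class_function {..<M} (\<lambda>s. \<Sum>a<M. \<Sum>b<M. \<phi> (T M a \<circ> T M b \<circ> s))"
  unfolding class_function_def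
proof (intro allI impI)
  fix r p :: "nat \<Rightarrow> nat" assume r: "r permutes {..<M}" and p: "p permutes {..<M}"
  have r': "r permutes {..<Suc M}" and p': "p permutes {..<Suc M}"
    by (rule permutes_subset[OF r] permutes_subset[OF p], auto)+
  have rT: "r \<circ> T M a \<circ> inv r = T M (r a)" for a
  proof -
    have "inv r M = M" using permutes_not_in[OF permutes_inv[OF r]] by simp
    then have "r \<circ> T M a = T M (r a) \<circ> r"
      using transpose_comp_eq[OF permutes_bij[OF r], of M "r a"]
      by (simp add: permutes_inverses[OF r])
    then show ?thesis by (simp add: comp_assoc permutes_inv_o[OF r])
  qed
  have "(\<Sum>a<M. \<Sum>b<M. \<phi> (T M a \<circ> T M b \<circ> p)) =
      (\<Sum>a<M. \<Sum>b<M. \<phi> (r \<circ> (T M a \<circ> T M b \<circ> p) \<circ> inv r))"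
    using p' by (intro sum.cong refl class_functionD[OF \<phi> r', symmetric] permutes_compose permutes_swap_id) auto
  also have "\<dots> = (\<Sum>a<M. \<Sum>b<M. \<phi> (T M (r a) \<circ> T M (r b) \<circ> (r \<circ> p \<circ> inv r)))"
  proof (intro sum.cong refl arg_cong[of _ _ \<phi>])
    fix a b
    have "r \<circ> (T M a \<circ> T M b \<circ> p) \<circ> inv r =
      (r \<circ> T M a \<circ> inv r) \<circ> (r \<circ> T M b \<circ> inv r) \<circ> (r \<circ> p \<circ> inv r)"
      by (simp add: fun_eq_iff permutes_inverses[OF r])
    then show "r \<circ> (T M a \<circ> T M b \<circ> p) \<circ> inv r = T M (r a) \<circ> T M (r b) \<circ> (r \<circ> p \<circ> inv r)"
      by (simp only: rT)
  qed
  also have "\<dots> = (\<Sum>a<M. \<Sum>b<M. \<phi> (T M a \<circ> T M b \<circ> (r \<circ> p \<circ> inv r)))"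
    using sum.permute[OF r, of "\<lambda>a. \<Sum>b<M. \<phi> (T M a \<circ> T M b \<circ> (r \<circ> p \<circ> inv r))"]
      sum.permute[OF r, of "\<lambda>b. \<phi> (T M (r a) \<circ> T M b \<circ> (r \<circ> p \<circ> inv r))" for a]
    by (simp add: comp_def)
  finally show "(\<Sum>a<M. \<Sum>b<M. \<phi> (T M a \<circ> T M b \<circ> (r \<circ> p \<circ> inv r))) =
      (\<Sum>a<M. \<Sum>b<M. \<phi> (T M a \<circ> T M b \<circ> p))" by simp
qed

text \<open>The weight is 2 on odd permutations and 0 on even ones, so this is twice the sum over
  the odd permutations. Written with \<open>sign\<close>, it splits into a plain sum and a signed
  sum.\<close>

definition odd_sum :: "nat \<Rightarrow> ((nat \<Rightarrow> nat) \<Rightarrow> real) \<Rightarrow> real" where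
  "odd_sum N \<phi> = (\<Sum>s | s permutes {..<N}. (1 - of_int (sign s)) * \<phi> s)"

text \<open>A product of two \<open>N\<close>-cycles is even, so inserting the point
  \<open>N\<close> into it by \<open>T N a\<close> produces an odd permutation of
  \<open>N + 1\<close> points; every choice of the cycles and of the place \<open>a\<close> is
  counted.\<close>

definition factorization_sum :: "nat \<Rightarrow> ((nat \<Rightarrow> nat) \<Rightarrow> real) \<Rightarrow> real" where
  "factorization_sum N \<phi> =
     (\<Sum>c\<in>long_cycles N. \<Sum>z\<in>long_cycles N. \<Sum>a<N. \<phi> (T N a \<circ> (c \<circ> z)))"

section \<open>Recursions for odd sums and factorization sums\<close>

lemma sum_permutes_Suc:
  "(\<Sum>s | s permutes {..<Suc M}. f s) =
    (\<Sum>s | s permutes {..<M}. f s) + (\<Sum>b<M. \<Sum>s | s permutes {..<M}. f (T M b \<circ> s))"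
  for f :: "(nat \<Rightarrow> nat) \<Rightarrow> real"
proof -
  have "(\<Sum>s | s permutes insert M {..<M}. f s) =
     (\<Sum>b\<in>insert M {..<M}. \<Sum>q | q permutes {..<M}. f (T M b \<circ> q))"
    by (rule sum_over_permutations_insert) auto
  then show ?thesis by (simp add: lessThan_Suc)
qed

text \<open>Two transpositions preserve the sign, so the weight can be moved inside. For fixed
  \<open>a\<close>, extending the inner sum to all permutations of \<open>M + 1\<close> points makes
  it independent of \<open>a\<close>. The correction terms, summed over \<open>a\<close>, are again
  a full sum minus the part fixing \<open>M\<close>.\<close>

lemma odd_sum_double_insertion:
  "odd_sum M (\<lambda>s. \<Sum>a<M. \<Sum>b<M. \<phi> (T M a \<circ> T M b \<circ> s)) =
    (real M - 1) * odd_sum (Suc M) \<phi> + odd_sum M \<phi>"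
proof -
  define g where "g s = (1 - of_int (sign s)) * \<phi> s" for s
  have sgn: "sign (T M a \<circ> T M b \<circ> s) = sign s" if "a < M" "b < M" "s permutes {..<M}" for a b s
  proof -
    have "permutation s" using permutes_imp_permutation[OF _ that(3)] by simp
    then show ?thesis
      using that by (simp add: sign_compose permutation_compose permutation_swap_id sign_swap_id)
  qed
  have "odd_sum M (\<lambda>s. \<Sum>a<M. \<Sum>b<M. \<phi> (T M a \<circ> T M b \<circ> s)) =
      (\<Sum>s | s permutes {..<M}. \<Sum>a<M. \<Sum>b<M. g (T M a \<circ> T M b \<circ> s))"
    unfolding odd_sum_def g_def sum_distrib_left using sgn by (intro sum.cong refl) auto
  also have "\<dots> = (\<Sum>a<M. \<Sum>b<M. \<Sum>s | s permutes {..<M}. g (T M a \<circ> (T M b \<circ> s)))"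
    by (subst sum.swap, rule sum.cong[OF refl], subst sum.swap) (simp add: comp_assoc)
  \<comment> \<open>The products \<open>T M b \<circ> s\<close> with \<open>b < M\<close> are
    exactly the permutations of \<open>M + 1\<close> points that move \<open>M\<close>.\<close>
  also have "\<dots> = (\<Sum>a<M. (\<Sum>s | s permutes {..<Suc M}. g (T M a \<circ> s)) -
      (\<Sum>s | s permutes {..<M}. g (T M a \<circ> s)))"
    using sum_permutes_Suc[of "\<lambda>s. g (T M a \<circ> s)" M for a] by simp
  also have "\<dots> = (\<Sum>a<M. (\<Sum>s | s permutes {..<Suc M}. g s)) -
      (\<Sum>a<M. \<Sum>s | s permutes {..<M}. g (T M a \<circ> s))"
    unfolding sum_subtractf
    by (intro arg_cong2[of _ _ _ _ "(-)"] sum.cong refl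
        setum_permutations_compose_left[symmetric] permutes_swap_id) auto
  also have "\<dots> = (real M - 1) * (\<Sum>s | s permutes {..<Suc M}. g s) + (\<Sum>s | s permutes {..<M}. g s)"
    using sum_permutes_Suc[of g M] by (simp add: algebra_simps)
  finally show ?thesis unfolding odd_sum_def g_def .
qed

text \<open>Conjugation by \<open>T N b\<close> carries the insertion place \<open>N\<close> to
  \<open>b\<close> and permutes the long cycles, so all \<open>N + 1\<close> places contribute
  equally.\<close>

lemma factorization_sum_Suc:
  assumes \<phi>: "class_function {..<Suc (Suc N)} \<phi>"
  shows "factorization_sum (Suc N) \<phi> = real (Suc N) *
    (\<Sum>c\<in>long_cycles (Suc N). \<Sum>z\<in>long_cycles (Suc N). \<phi> (T (Suc N) N \<circ> (c \<circ> z)))"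
    (is "_ = _ * ?Q")
proof -
  let ?L = "long_cycles (Suc N)"
  have indep: "(\<Sum>c\<in>?L. \<Sum>z\<in>?L. \<phi> (T (Suc N) b \<circ> (c \<circ> z))) = ?Q" if b: "b < Suc N" for b
  proof -
    let ?r = "T N b"
    have r: "?r permutes {..<Suc N}" using b by (intro permutes_swap_id) auto
    have r': "?r permutes {..<Suc (Suc N)}" using b by (intro permutes_swap_id) auto
    have "?Q = (\<Sum>c\<in>?L. \<Sum>z\<in>?L. \<phi> (T (Suc N) b \<circ> ((?r \<circ> c \<circ> inv ?r) \<circ> (?r \<circ> z \<circ> inv ?r))))"
    proof (intro sum.cong refl)
      fix c z assume "c \<in> ?L" "z \<in> ?L"
      then have "c permutes {..<Suc (Suc N)}" "z permutes {..<Suc (Suc N)}"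
        by (auto dest!: long_cycles_permutes intro: permutes_subset)
      then have "T (Suc N) N \<circ> (c \<circ> z) permutes {..<Suc (Suc N)}"
        by (intro permutes_compose permutes_swap_id) auto
      from class_functionD[OF \<phi> r' this]
      have "\<phi> (T (Suc N) N \<circ> (c \<circ> z)) = \<phi> (?r \<circ> (T (Suc N) N \<circ> (c \<circ> z)) \<circ> inv ?r)" by simp
      also have "?r \<circ> (T (Suc N) N \<circ> (c \<circ> z)) \<circ> inv ?r =
          (?r \<circ> T (Suc N) N \<circ> ?r) \<circ> ((?r \<circ> c \<circ> inv ?r) \<circ> (?r \<circ> z \<circ> inv ?r))"
        by (simp add: fun_eq_iff)
      also have "?r \<circ> T (Suc N) N \<circ> ?r = T (Suc N) b"
        using b by (auto simp: fun_eq_iff Transposition.transpose_def)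
      finally show "\<phi> (T (Suc N) N \<circ> (c \<circ> z)) =
          \<phi> (T (Suc N) b \<circ> ((?r \<circ> c \<circ> inv ?r) \<circ> (?r \<circ> z \<circ> inv ?r)))" .
    qed
    also have "\<dots> = (\<Sum>c\<in>?L. \<Sum>z\<in>?L. \<phi> (T (Suc N) b \<circ> ((?r \<circ> c \<circ> inv ?r) \<circ> z)))"
      by (intro sum.cong refl sum_long_cycles_conj[OF r, of "\<lambda>z. \<phi> (T (Suc N) b \<circ> (c \<circ> z))" for c])
    also have "\<dots> = (\<Sum>c\<in>?L. \<Sum>z\<in>?L. \<phi> (T (Suc N) b \<circ> (c \<circ> z)))"
      by (rule sum_long_cycles_conj[OF r])
    finally show ?thesis by simp
  qed
  have "(\<Sum>b<Suc N. \<Sum>c\<in>?L. \<Sum>z\<in>?L. \<phi> (T (Suc N) b \<circ> (c \<circ> z))) = (\<Sum>b<Suc N. ?Q)"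
    by (rule sum.cong[OF refl], rule indep) simp
  moreover have "factorization_sum (Suc N) \<phi> =
      (\<Sum>b<Suc N. \<Sum>c\<in>?L. \<Sum>z\<in>?L. \<phi> (T (Suc N) b \<circ> (c \<circ> z)))"
    unfolding factorization_sum_def
    by (subst sum.swap[of _ "long_cycles (Suc N)" "{..<Suc N}"], rule sum.cong[OF refl], rule sum.swap)
  ultimately show ?thesis by simp
qed

text \<open>In the double insertion, split the pairs \<open>(a, b)\<close>. Those with
  \<open>a < N\<close> give \<open>factorization_sum (Suc N) \<phi>\<close>, those with
  \<open>a = N\<close> and \<open>b < N\<close> give \<open>Q\<close>, and \<open>a = b = N\<close>
  gives back \<open>factorization_sum N \<phi>\<close>. As \<open>Q\<close> is the first of these
  divided by \<open>N + 1\<close>, the stated coefficient results.\<close>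

lemma factorization_sum_step:
  assumes N: "N \<ge> 1" and \<phi>: "class_function {..<Suc (Suc N)} \<phi>"
  shows "(real N + 2) / (real N + 1) * factorization_sum (Suc N) \<phi> =
    factorization_sum N (\<lambda>s. \<Sum>a<Suc N. \<Sum>b<Suc N. \<phi> (T (Suc N) a \<circ> T (Suc N) b \<circ> s)) -
    factorization_sum N \<phi>"
proof -
  let ?k = "Suc N" and ?L = "long_cycles N"
  define Q where "Q = (\<Sum>c\<in>long_cycles ?k. \<Sum>z\<in>long_cycles ?k. \<phi> (T ?k N \<circ> (c \<circ> z)))"
  have perm: "T N a \<circ> (c \<circ> z) permutes {..<Suc ?k}" "c permutes {..<Suc ?k}"
      "z permutes {..<Suc ?k}" "c \<circ> z permutes {..<N}"
    if "c \<in> ?L" "z \<in> ?L" "a < N" for a c z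
  proof -
    have c: "c permutes {..<N}" "z permutes {..<N}" using that by (auto dest: long_cycles_permutes)
    then show "c permutes {..<Suc ?k}" "z permutes {..<Suc ?k}" by (auto intro: permutes_subset)
    then show "T N a \<circ> (c \<circ> z) permutes {..<Suc ?k}"
      using that by (intro permutes_compose permutes_swap_id) auto
    show "c \<circ> z permutes {..<N}" using c by (intro permutes_compose)
  qed
  have sw: "T ?k b permutes {..<Suc ?k}" "T N b permutes {..<Suc ?k}" if "b < Suc N" for b
    using that by (auto intro!: permutes_swap_id)

  \<comment> \<open>The point \<open>N\<close> is removed from the first cycle on the left and from
    the second on the right; the class function property then brings the right factor to the
    front.\<close>
  have "factorization_sum ?k \<phi> = (\<Sum>c\<in>?L. \<Sum>a<N. \<Sum>z\<in>?L. \<Sum>a'<N. \<Sum>b<?k.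
      \<phi> (T ?k b \<circ> ((T N a \<circ> c) \<circ> (z \<circ> T N a'))))"
    unfolding factorization_sum_def
    by (subst sum_long_cycles_Suc_left[OF N]) (intro sum.cong refl sum_long_cycles_Suc_right[OF N])
  also have "\<dots> = (\<Sum>c\<in>?L. \<Sum>a<N. \<Sum>z\<in>?L. \<Sum>a'<N. \<Sum>b<?k.
      \<phi> (T N a' \<circ> T ?k b \<circ> T N a \<circ> (c \<circ> z)))"
  proof (intro sum.cong refl)
    fix c a z a' b assume *: "c \<in> ?L" "a \<in> {..<N}" "z \<in> ?L" "a' \<in> {..<N}" "b \<in> {..<?k}"
    have "\<phi> ((T ?k b \<circ> (T N a \<circ> (c \<circ> z))) \<circ> T N a') = \<phi> (T N a' \<circ> (T ?k b \<circ> (T N a \<circ> (c \<circ> z))))"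
      using * by (intro class_function_commute[OF \<phi>] permutes_compose[of _ _ "T ?k b"] perm sw) auto
    then show "\<phi> (T ?k b \<circ> ((T N a \<circ> c) \<circ> (z \<circ> T N a'))) =
        \<phi> (T N a' \<circ> T ?k b \<circ> T N a \<circ> (c \<circ> z))" by (simp add: comp_assoc)
  qed
  also have "\<dots> = (\<Sum>c\<in>?L. \<Sum>z\<in>?L. \<Sum>a'<N. \<Sum>a<N. \<Sum>b<?k.
      \<phi> (T N a' \<circ> T ?k b \<circ> T N a \<circ> (c \<circ> z)))"
    by (intro sum.cong refl, subst sum.swap, rule sum.cong[OF refl], rule sum.swap)
  \<comment> \<open>The exchange of the two new points gives the outer transposition the point
    \<open>Suc N\<close>, as the double insertion requires.\<close>
  also have "\<dots> = (\<Sum>c\<in>?L. \<Sum>z\<in>?L. \<Sum>a'<N. \<Sum>a<N. \<Sum>b<?k.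
      \<phi> (T ?k a' \<circ> T ?k b \<circ> T N a \<circ> (c \<circ> z)))"
    by (intro sum.cong refl sum_transposition_triple_exchange[OF _ \<phi>] permutes_compose)
      (auto dest: long_cycles_permutes)
  finally have A: "factorization_sum ?k \<phi> = (\<Sum>c\<in>?L. \<Sum>z\<in>?L. \<Sum>a'<N. \<Sum>a<N. \<Sum>b<?k.
      \<phi> (T ?k a' \<circ> T ?k b \<circ> T N a \<circ> (c \<circ> z)))" .

  have "Q = (\<Sum>c\<in>?L. \<Sum>a<N. \<Sum>z\<in>?L. \<Sum>b<N. \<phi> (T ?k N \<circ> ((T N a \<circ> c) \<circ> (z \<circ> T N b))))"
    unfolding Q_def
    by (subst sum_long_cycles_Suc_left[OF N]) (intro sum.cong refl sum_long_cycles_Suc_right[OF N])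
  also have "\<dots> = (\<Sum>c\<in>?L. \<Sum>a<N. \<Sum>z\<in>?L. \<Sum>b<N. \<phi> (T ?k N \<circ> T ?k b \<circ> T N a \<circ> (c \<circ> z)))"
  proof (intro sum.cong refl)
    fix c a z b assume *: "c \<in> ?L" "a \<in> {..<N}" "z \<in> ?L" "b \<in> {..<N}"
    have "\<phi> ((T ?k N \<circ> (T N a \<circ> (c \<circ> z))) \<circ> T N b) = \<phi> (T N b \<circ> (T ?k N \<circ> (T N a \<circ> (c \<circ> z))))"
      using * by (intro class_function_commute[OF \<phi>] permutes_compose[of _ _ "T ?k N"] perm sw) auto
    \<comment> \<open>This product is a 3-cycle; the chosen factorization makes both transpositions
      involve the point \<open>Suc N\<close>.\<close>
    moreover have "T N b \<circ> T ?k N = T ?k N \<circ> T ?k b"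
      using * by (auto simp: fun_eq_iff Transposition.transpose_def)
    then have "T N b \<circ> (T ?k N \<circ> (T N a \<circ> (c \<circ> z))) = T ?k N \<circ> T ?k b \<circ> T N a \<circ> (c \<circ> z)"
      by (metis comp_assoc)
    ultimately show "\<phi> (T ?k N \<circ> ((T N a \<circ> c) \<circ> (z \<circ> T N b))) =
        \<phi> (T ?k N \<circ> T ?k b \<circ> T N a \<circ> (c \<circ> z))" by (simp add: comp_assoc)
  qed
  also have "\<dots> = (\<Sum>c\<in>?L. \<Sum>z\<in>?L. \<Sum>a<N. \<Sum>b<N. \<phi> (T ?k N \<circ> T ?k b \<circ> T N a \<circ> (c \<circ> z)))"
    by (rule sum.cong[OF refl], rule sum.swap)
  finally have Q: "Q = (\<Sum>c\<in>?L. \<Sum>z\<in>?L. \<Sum>a<N. \<Sum>b<N. \<phi> (T ?k N \<circ> T ?k b \<circ> T N a \<circ> (c \<circ> z)))" .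

  have split: "(\<Sum>a'<N. \<Sum>a<?k. \<Sum>b<?k. \<phi> (T ?k a \<circ> T ?k b \<circ> (T N a' \<circ> w))) =
      (\<Sum>a<N. \<Sum>a'<N. \<Sum>b<?k. \<phi> (T ?k a \<circ> T ?k b \<circ> T N a' \<circ> w)) +
      (\<Sum>a'<N. \<Sum>b<N. \<phi> (T ?k N \<circ> T ?k b \<circ> T N a' \<circ> w)) +
      (\<Sum>a'<N. \<phi> (T N a' \<circ> w))" for w
  proof -
    have "(\<Sum>a'<N. \<Sum>a<?k. \<Sum>b<?k. \<phi> (T ?k a \<circ> T ?k b \<circ> (T N a' \<circ> w))) =
        (\<Sum>a'<N. (\<Sum>a<N. \<Sum>b<?k. \<phi> (T ?k a \<circ> T ?k b \<circ> T N a' \<circ> w)) +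
          ((\<Sum>b<N. \<phi> (T ?k N \<circ> T ?k b \<circ> T N a' \<circ> w)) + \<phi> (T N a' \<circ> w)))"
    proof (rule sum.cong[OF refl])
      fix a'
      have "T ?k N \<circ> T ?k N \<circ> (T N a' \<circ> w) = T N a' \<circ> w" by simp
      then show "(\<Sum>a<?k. \<Sum>b<?k. \<phi> (T ?k a \<circ> T ?k b \<circ> (T N a' \<circ> w))) =
          (\<Sum>a<N. \<Sum>b<?k. \<phi> (T ?k a \<circ> T ?k b \<circ> T N a' \<circ> w)) +
          ((\<Sum>b<N. \<phi> (T ?k N \<circ> T ?k b \<circ> T N a' \<circ> w)) + \<phi> (T N a' \<circ> w))"
        unfolding sum.lessThan_Suc[where n = N and g = "\<lambda>a. \<Sum>b<?k. f a b" for f]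
          sum.lessThan_Suc[where n = N and g = "\<lambda>b. \<phi> (T ?k N \<circ> T ?k b \<circ> (T N a' \<circ> w))"]
        by (simp only: comp_assoc)
    qed
    also have "\<dots> = (\<Sum>a'<N. \<Sum>a<N. \<Sum>b<?k. \<phi> (T ?k a \<circ> T ?k b \<circ> T N a' \<circ> w)) +
      ((\<Sum>a'<N. \<Sum>b<N. \<phi> (T ?k N \<circ> T ?k b \<circ> T N a' \<circ> w)) + (\<Sum>a'<N. \<phi> (T N a' \<circ> w)))"
      by (simp only: sum.distrib)
    also have "(\<Sum>a'<N. \<Sum>a<N. \<Sum>b<?k. \<phi> (T ?k a \<circ> T ?k b \<circ> T N a' \<circ> w)) =
      (\<Sum>a<N. \<Sum>a'<N. \<Sum>b<?k. \<phi> (T ?k a \<circ> T ?k b \<circ> T N a' \<circ> w))" by (rule sum.swap)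
    finally show ?thesis by (simp only: add.assoc)
  qed
  have "factorization_sum N (\<lambda>s. \<Sum>a<?k. \<Sum>b<?k. \<phi> (T ?k a \<circ> T ?k b \<circ> s)) =
      factorization_sum ?k \<phi> + Q + factorization_sum N \<phi>"
    unfolding A Q unfolding factorization_sum_def split by (simp only: sum.distrib)
  moreover have "factorization_sum ?k \<phi> = (real N + 1) * Q"
    unfolding Q_def using factorization_sum_Suc[OF \<phi>] by (simp add: add.commute)
  ultimately show ?thesis by (simp add: field_simps)
qed

text \<open>
  Equivalently, every odd permutation of \<open>N + 1\<close> points has the same number \<open>2 (N - 1)!\<close> of
  factorizations into an \<open>(N + 1)\<close>-cycle and an \<open>N\<close>-cycle: \<open>T N a \<circ> c\<close> runs through the
  \<open>(N + 1)\<close>-cycles.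
\<close>

theorem factorization_sum_eq_odd_sum:
  assumes "N \<ge> 1" "class_function {..<Suc N} \<phi>"
  shows "(real N + 1) * factorization_sum N \<phi> = fact (N - 1) * odd_sum (Suc N) \<phi>"
  using assms
proof (induction N arbitrary: \<phi> rule: nat_induct_at_least)
  case base
  have "{s. s permutes {..<2::nat}} = {id, T 0 1}"
    by (auto simp: numeral_2_eq_2 lessThan_Suc permutes_doubleton_iff insert_commute transpose_commute)
  moreover have "id \<noteq> T 0 1" by (metis transpose_eq_id_iff zero_neq_one)
  ultimately have "odd_sum 2 \<phi> = 2 * \<phi> (T 0 1)"
    by (simp add: odd_sum_def sign_swap_id)
  then show ?case
    by (simp add: factorization_sum_def long_cycles_1 numeral_2_eq_2 transpose_commute)
next
  case (Suc N)
  \<comment> \<open>The induction hypothesis is needed for \<open>?\<psi>\<close> as well as for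
    \<open>\<phi>\<close>, which is why the induction ranges over all class functions even though
    only cycle counts matter later.\<close>
  let ?\<psi> = "\<lambda>s. \<Sum>a<Suc N. \<Sum>b<Suc N. \<phi> (T (Suc N) a \<circ> T (Suc N) b \<circ> s)"
  have \<phi>': "class_function {..<Suc N} \<phi>" by (rule class_function_subset[OF Suc.prems]) auto
  have \<psi>: "class_function {..<Suc N} ?\<psi>" by (rule class_function_double_insertion[OF Suc.prems])
  have "(real N + 2) * factorization_sum (Suc N) \<phi> =
      (real N + 1) * ((real N + 2) / (real N + 1) * factorization_sum (Suc N) \<phi>)"
    by (simp add: field_simps)
  also have "\<dots> = (real N + 1) * factorization_sum N ?\<psi> - (real N + 1) * factorization_sum N \<phi>"
    unfolding factorization_sum_step[OF Suc.hyps Suc.prems] by (simp only: right_diff_distrib)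
  also have "\<dots> = fact (N - 1) * (odd_sum (Suc N) ?\<psi> - odd_sum (Suc N) \<phi>)"
    unfolding Suc.IH[OF \<psi>] Suc.IH[OF \<phi>'] by (simp only: right_diff_distrib)
  also have "odd_sum (Suc N) ?\<psi> - odd_sum (Suc N) \<phi> = real N * odd_sum (Suc (Suc N)) \<phi>"
    unfolding odd_sum_double_insertion by simp
  also have "fact (N - 1) * (real N * odd_sum (Suc (Suc N)) \<phi>) = fact N * odd_sum (Suc (Suc N)) \<phi>"
    using Suc.hyps by (simp add: fact_reduce)
  finally show ?case by (simp add: add.commute)
qed

section \<open>Block interchanges and the cycle graph\<close>

definition rotation :: "nat \<Rightarrow> nat \<Rightarrow> nat" where
  "rotation n i = (if i < n then Suc i else if i = n then 0 else i)"

lemma rotation_permutes: "rotation n permutes {..<Suc n}"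
proof (rule inj_imp_permutes)
  show "inj_on (rotation n) {..<Suc n}"
    by (auto simp: inj_on_def rotation_def split: if_splits)
qed (auto simp: rotation_def)

lemma rotation_funpow: "i \<le> n \<Longrightarrow> (rotation n ^^ i) 0 = i"
  by (induction i) (auto simp: rotation_def)

lemma rotation_long_cycle: "rotation n \<in> long_cycles (Suc n)"
proof -
  have "0 \<in> orbit (rotation n) 0"
    using funpow_in_orbit self_in_orbit[OF _ rotation_permutes, of n 0] by simp
  then have *: "i \<in> orbit (rotation n) 0" if "i \<le> n" for i
    using funpow_in_orbit[of 0 "rotation n" 0 i] rotation_funpow[OF that] by simp
  have "y \<in> orbit (rotation n) x" if "x < Suc n" "y < Suc n" for x y
    using orbit_eq_of_mem[OF _ rotation_permutes *, of x] *[of y] that by simp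
  then have "ncycles {..<Suc n} (rotation n) = 1"
    by (subst ncycles_eq_1_iff) (auto simp: rotation_permutes lessThan_empty_iff)
  then show ?thesis by (simp add: long_cycles_def rotation_permutes)
qed

text \<open>
  A word \<open>p\<^sub>1 \<dots> p\<^sub>n\<close> is extended by \<open>p\<^sub>0 = 0\<close>; \<open>word_cycle\<close> is the cycle \<open>(0 p\<^sub>1 \<dots> p\<^sub>n)\<close>.
\<close>

definition word_perm :: "nat list \<Rightarrow> nat \<Rightarrow> nat" where
  "word_perm p i = (if i \<le> length p then (0 # p) ! i else i)"

lemma word_perm_0 [simp]: "word_perm p 0 = 0"
  by (simp add: word_perm_def)

lemma length_permutations_of_set_upto:
  "p \<in> permutations_of_set {1..n} \<Longrightarrow> length p = n"
  by (simp add: length_finite_permutations_of_set)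

lemma word_perm_permutes:
  assumes "p \<in> permutations_of_set {1..n}"
  shows "word_perm p permutes {..<Suc n}"
proof (rule inj_imp_permutes)
  note len = length_permutations_of_set_upto[OF assms]
  have p: "set p = {1..n}" "distinct p" using permutations_of_setD[OF assms] by auto
  have d: "distinct (0 # p)" using p by simp
  show "inj_on (word_perm p) {..<Suc n}"
    using d by (intro inj_onI) (simp add: word_perm_def len nth_eq_iff_index_eq del: distinct.simps)
  fix i assume "i \<in> {..<Suc n}"
  then have "(0 # p) ! i \<in> set (0 # p)" by (intro nth_mem) (simp add: len)
  also have "set (0 # p) = {..<Suc n}" using p by auto
  finally show "word_perm p i \<in> {..<Suc n}" using \<open>i \<in> _\<close> by (simp add: word_perm_def len)
qed (auto simp: word_perm_def length_permutations_of_set_upto[OF assms])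

definition word_cycle :: "nat list \<Rightarrow> nat \<Rightarrow> nat" where
  "word_cycle p = word_perm p \<circ> rotation (length p) \<circ> inv (word_perm p)"

lemma word_cycle_long_cycle:
  assumes "p \<in> permutations_of_set {1..n}"
  shows "word_cycle p \<in> long_cycles (Suc n)"
  unfolding word_cycle_def length_permutations_of_set_upto[OF assms]
  by (rule long_cycles_conj[OF word_perm_permutes[OF assms] rotation_long_cycle])

section \<open>Block interchanges as products of two transpositions\<close>

text \<open>
  The position before the interchange of the entry that ends up at position \<open>i\<close>, where the two blocks
  occupy the positions \<open>{i1<..i2}\<close> and \<open>{i3<..i4}\<close>.
\<close>

definition block_map :: "nat \<Rightarrow> nat \<Rightarrow> nat \<Rightarrow> nat \<Rightarrow> nat \<Rightarrow> nat" where
  "block_map i1 i2 i3 i4 i =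
     (if i \<le> i1 then i
      else if i \<le> i1 + (i4 - i3) then i + (i3 - i1)
      else if i \<le> i1 + (i4 - i2) then (i + i2) + i3 - (i1 + i4)
      else if i \<le> i4 then i - (i4 - i2)
      else i)"

text \<open>An interchange changes successors only at the cuts. In old positions, \<open>i1\<close>
  is now followed by the successor of \<open>i3\<close>, and \<open>i2\<close> by that of
  \<open>i4\<close>. If the middle is nonempty, \<open>i3\<close> is followed by the successor of
  \<open>i1\<close>, and \<open>i4\<close> by that of \<open>i2\<close>; if \<open>i2 = i3\<close>,
  then \<open>i4\<close> is followed by the successor of \<open>i1\<close>. The order of the two
  transpositions makes one formula cover both situations.\<close>

lemma block_map_rotation:
  assumes "i1 < i2" "i2 \<le> i3" "i3 < i4" "i4 \<le> n"
  shows "block_map i1 i2 i3 i4 (rotation n i) =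
    rotation n (T i1 i3 (T i2 i4 (block_map i1 i2 i3 i4 i)))"
proof -
  \<comment> \<open>The blocks have lengths \<open>x + 1\<close> and \<open>z + 1\<close>, the
    stretch between them has length \<open>y\<close>; these parameters remove truncated
    subtractions.\<close>
  obtain x where i2: "i2 = Suc (i1 + x)" using assms(1) less_imp_Suc_add by blast
  obtain y where i3: "i3 = Suc (i1 + x) + y" using assms(2) i2 le_Suc_ex by blast
  obtain z where i4: "i4 = Suc (Suc (i1 + x) + y + z)" using assms(3) i3 less_imp_Suc_add by blast
  note eqs = i2 i3 i4
  let ?b = "block_map i1 i2 i3 i4"
  have b: "?b j = (if j \<le> i1 then j else if j \<le> Suc (i1 + z) then Suc (j + x + y)
      else if j \<le> Suc (i1 + z + y) then j + x - z else if j \<le> i4 then j - Suc (y + z) else j)" for j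
    unfolding block_map_def eqs by simp
  \<comment> \<open>New positions are sorted by segment, with the last position before each cut
    treated separately. For \<open>y = 0\<close> two of these ends coincide, hence the side
    condition \<open>y > 0\<close> and the case split on \<open>y\<close>.\<close>
  consider "i < i1" | "i = i1" | "i1 < i" "i < Suc (i1 + z)" | "i = Suc (i1 + z)"
    | "Suc (i1 + z) < i" "i < Suc (i1 + z + y)" | "i = Suc (i1 + z + y)" "y > 0"
    | "Suc (i1 + z + y) < i" "i < i4" | "i = i4" | "i4 < i" "i < n" | "i4 < i" "i = n" | "i > n"
    by linarith
  then show ?thesis
  proof cases
    case 4
    then show ?thesis
      unfolding b using assms(4) by (cases y) (simp_all add: eqs rotation_def Transposition.transpose_def)
  next
    case 5
    then obtain t where t: "i = Suc (Suc (i1 + z)) + t" using le_Suc_ex Suc_leI by blast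
    then have "i + x - z = Suc (Suc (i1 + x + t))" "Suc i + x - z = Suc (Suc (Suc (i1 + x + t)))" by simp_all
    then show ?thesis
      unfolding b using assms(4) 5 t by (simp add: eqs rotation_def Transposition.transpose_def)
  next
    case 7
    then obtain t where t: "i = Suc (Suc (i1 + z + y)) + t" using le_Suc_ex Suc_leI by blast
    then have "i - Suc (y + z) = Suc (i1 + t)" "Suc i - Suc (y + z) = Suc (Suc (i1 + t))" by simp_all
    then show ?thesis
      unfolding b using assms(4) 7 t by (simp add: eqs rotation_def Transposition.transpose_def)
  qed (unfold b, use assms(4) in \<open>simp_all add: eqs rotation_def Transposition.transpose_def\<close>)
qed

lemma word_perm_block_interchange:
  fixes us as vs bs ws :: "nat list"
  defines "p \<equiv> us @ as @ vs @ bs @ ws" and "p' \<equiv> us @ bs @ vs @ as @ ws"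
  shows "word_perm p' = word_perm p \<circ> block_map (length us) (length us + length as)
    (length us + length as + length vs) (length us + length as + length vs + length bs)"
proof
  fix i
  let ?b = "block_map (length us) (length us + length as)
    (length us + length as + length vs) (length us + length as + length vs + length bs)"
  show "word_perm p' i = (word_perm p \<circ> ?b) i"
  proof (cases i)
    case (Suc j)
    consider "j < length us" | "length us \<le> j" "j < length us + length bs"
      | "length us + length bs \<le> j" "j < length us + length bs + length vs"
      | "length us + length bs + length vs \<le> j" "j < length us + length bs + length vs + length as"
      | "length us + length bs + length vs + length as \<le> j" by linarith
    then show ?thesis
    proof cases
      case 1
      then have "?b i = i" by (simp add: Suc block_map_def)
      then show ?thesis using 1 by (simp add: Suc word_perm_def p_def p'_def nth_append)
    next
      case 2
      then obtain t where t: "j = length us + t" "t < length bs" by (metis add_less_cancel_left le_Suc_ex)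
      then have "?b i = Suc (length us + (length as + (length vs + t)))"
        by (simp add: Suc block_map_def)
      then show ?thesis using t by (simp add: Suc word_perm_def p_def p'_def nth_append)
    next
      case 3
      then obtain t where t: "j = length us + length bs + t" "t < length vs"
        by (metis add_less_cancel_left le_Suc_ex)
      then have "?b i = Suc (length us + (length as + t))"
        by (simp add: Suc block_map_def)
      then show ?thesis using t by (simp add: Suc word_perm_def p_def p'_def nth_append)
    next
      case 4
      then obtain t where t: "j = length us + length bs + length vs + t" "t < length as"
        by (metis add_less_cancel_left le_Suc_ex)
      then have "?b i = Suc (length us + t)"
        by (simp add: Suc block_map_def)
      then show ?thesis using t by (simp add: Suc word_perm_def p_def p'_def nth_append)
    next
      case 5
      then obtain t where t: "j = length us + length bs + length vs + length as + t"
        by (metis le_Suc_ex)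
      then have "?b i = Suc (length us + (length as + (length vs + (length bs + t))))"
        by (simp add: Suc block_map_def)
      then show ?thesis using t by (simp add: Suc word_perm_def p_def p'_def nth_append)
    qed
  qed (simp add: block_map_def)
qed

lemma block_interchange_permutations_of_set:
  assumes "block_interchange p p'" "p \<in> permutations_of_set A"
  shows "p' \<in> permutations_of_set A"
  using assms by cases (auto simp: permutations_of_set_def)

lemma block_interchangeE:
  assumes "block_interchange p p'"
  obtains i1 i2 i3 i4 where "i1 < i2" "i2 \<le> i3" "i3 < i4" "i4 \<le> length p"
    "word_perm p' = word_perm p \<circ> block_map i1 i2 i3 i4"
  using assms
proof cases
  case (1 as bs us vs ws)
  show thesis
    by (rule that[OF _ _ _ _ word_perm_block_interchange[of us bs vs as ws, folded 1(1,2)]])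
      (use 1 in auto)
qed

lemma block_interchange_exists:
  assumes "i1 < i2" "i2 \<le> i3" "i3 < i4" "i4 \<le> length p"
  obtains p' where "block_interchange p p'" "word_perm p' = word_perm p \<circ> block_map i1 i2 i3 i4"
proof -
  define us as vs bs ws where "us = take i1 p" and "as = take (i2 - i1) (drop i1 p)"
    and "vs = take (i3 - i2) (drop i2 p)" and "bs = take (i4 - i3) (drop i3 p)" and "ws = drop i4 p"
  have d: "drop i p = take (j - i) (drop i p) @ drop j p" if "i \<le> j" for i j
    using append_take_drop_id[of "j - i" "drop i p"] that by simp
  have p: "p = us @ as @ vs @ bs @ ws"
    unfolding us_def as_def vs_def bs_def ws_def
    using d[of i1 i2] d[of i2 i3] d[of i3 i4] assms append_take_drop_id[of i1 p] by simp
  have len: "length us = i1" "length as = i2 - i1" "length vs = i3 - i2" "length bs = i4 - i3"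
    using assms by (auto simp: us_def as_def vs_def bs_def)
  have "block_interchange p (us @ bs @ vs @ as @ ws)"
    unfolding p using len assms by (intro block_interchange.intros) auto
  moreover have "word_perm (us @ bs @ vs @ as @ ws) = word_perm p \<circ> block_map i1 i2 i3 i4"
    unfolding p using word_perm_block_interchange[of us bs vs as ws] assms by (simp add: len)
  ultimately show thesis by (rule that)
qed

lemma transpose_image_comp:
  assumes "inj q"
  shows "transpose (q x) (q y) (q z) = q (transpose x y z)"
  using assms by (auto simp: Transposition.transpose_def inj_eq)

text \<open>This is \<open>block_map_rotation\<close> transported from positions to entries:
  conjugating by \<open>word_perm p\<close> turns transpositions of positions into transpositions of
  the entries there.\<close>

lemma word_cycle_block_map:
  assumes p: "p \<in> permutations_of_set {1..n}" and p': "p' \<in> permutations_of_set {1..n}"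
    and i: "i1 < i2" "i2 \<le> i3" "i3 < i4" "i4 \<le> n"
    and eq: "word_perm p' = word_perm p \<circ> block_map i1 i2 i3 i4"
  shows "word_cycle p' = word_cycle p \<circ>
    transpose (word_perm p i1) (word_perm p i3) \<circ> transpose (word_perm p i2) (word_perm p i4)"
proof
  fix x
  let ?q = "word_perm p" and ?q' = "word_perm p'"
  note q = word_perm_permutes[OF p] and q' = word_perm_permutes[OF p']
  note tr = transpose_image_comp[OF permutes_inj[OF q]]
  obtain z where x: "x = ?q' z" using permutes_surj[OF q'] by (metis surjE)
  have "word_cycle p' x = ?q' (rotation n z)"
    by (simp add: word_cycle_def x permutes_inverses[OF q'] length_permutations_of_set_upto[OF p'])
  also have "\<dots> = ?q (rotation n (T i1 i3 (T i2 i4 (block_map i1 i2 i3 i4 z))))"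
    by (simp add: eq block_map_rotation[OF i])
  also have "\<dots> = word_cycle p (?q (T i1 i3 (T i2 i4 (block_map i1 i2 i3 i4 z))))"
    by (simp add: word_cycle_def permutes_inverses[OF q] length_permutations_of_set_upto[OF p])
  also have "?q (T i1 i3 (T i2 i4 (block_map i1 i2 i3 i4 z))) =
      T (?q i1) (?q i3) (T (?q i2) (?q i4) x)"
    by (simp add: tr x eq)
  finally show "word_cycle p' x = (word_cycle p \<circ>
    transpose (word_perm p i1) (word_perm p i3) \<circ> transpose (word_perm p i2) (word_perm p i4)) x"
    by simp
qed

text \<open>The cycles of this permutation are those of Christie's cycle graph.\<close>

definition breakpoint_perm :: "nat list \<Rightarrow> nat \<Rightarrow> nat" where
  "breakpoint_perm p = inv (rotation (length p)) \<circ> word_cycle p"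

lemma breakpoint_perm_permutes:
  assumes "p \<in> permutations_of_set {1..n}"
  shows "breakpoint_perm p permutes {..<Suc n}"
  unfolding breakpoint_perm_def length_permutations_of_set_upto[OF assms]
  by (intro permutes_compose permutes_inv rotation_permutes
      long_cycles_permutes[OF word_cycle_long_cycle[OF assms]])

text \<open>The breakpoint permutation is multiplied by two transpositions, each of which adds at
  most one cycle.\<close>

lemma ncycles_breakpoint_perm_block_interchange:
  assumes p: "p \<in> permutations_of_set {1..n}" and b: "block_interchange p p'"
  shows "ncycles {..<Suc n} (breakpoint_perm p') \<le> ncycles {..<Suc n} (breakpoint_perm p) + 2"
proof -
  let ?S = "{..<Suc n}" and ?q = "word_perm p" and ?t = "breakpoint_perm p"
  have p': "p' \<in> permutations_of_set {1..n}" by (rule block_interchange_permutations_of_set[OF b p])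
  note len = length_permutations_of_set_upto[OF p] length_permutations_of_set_upto[OF p']
  obtain i1 i2 i3 i4 where i: "i1 < i2" "i2 \<le> i3" "i3 < i4" "i4 \<le> n"
    and eq: "word_perm p' = word_perm p \<circ> block_map i1 i2 i3 i4"
    using block_interchangeE[OF b] len by metis
  have S: "?q j \<in> ?S" if "j \<le> n" for j
    using permutes_in_image[OF word_perm_permutes[OF p], of j] that by simp
  note t = breakpoint_perm_permutes[OF p]
  have eq': "breakpoint_perm p' = ?t \<circ> T (?q i1) (?q i3) \<circ> T (?q i2) (?q i4)"
    unfolding breakpoint_perm_def len word_cycle_block_map[OF p p' i eq] by (simp add: comp_assoc)
  have "ncycles ?S (?t \<circ> T (?q i1) (?q i3) \<circ> T (?q i2) (?q i4)) \<le>
      Suc (ncycles ?S (?t \<circ> T (?q i1) (?q i3)))"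
    using i by (intro ncycles_comp_transpose_le permutes_comp_transpose t S) auto
  also have "ncycles ?S (?t \<circ> T (?q i1) (?q i3)) \<le> Suc (ncycles ?S ?t)"
    using i by (intro ncycles_comp_transpose_le t S) auto
  finally show ?thesis unfolding eq' by simp
qed

text \<open>Multiplying the word cycle by the first transposition cuts it into two arcs, the
  positions \<open>{i<..k}\<close> and the rest. The points \<open>l\<close> and \<open>m\<close>
  lie on different arcs, so the chords cross or share one endpoint. In each such case the product
  can be rewritten in the form that comes from a block interchange.\<close>

lemma crossing_transpositions:
  assumes p: "p \<in> permutations_of_set {1..n}" and ik: "i < k" "k \<le> n" and lm: "l \<le> n" "m \<le> n"
    and nin: "word_perm p m \<notin> orbit (word_cycle p \<circ> T (word_perm p i) (word_perm p k)) (word_perm p l)"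
    and ne: "{l, m} \<noteq> {i, k}"
  obtains i1 i2 i3 i4 where "i1 < i2" "i2 \<le> i3" "i3 < i4" "i4 \<le> n"
    "T (word_perm p i) (word_perm p k) \<circ> T (word_perm p l) (word_perm p m) =
     T (word_perm p i1) (word_perm p i3) \<circ> T (word_perm p i2) (word_perm p i4)"
proof -
  let ?S = "{..<Suc n}" and ?q = "word_perm p" and ?g = "word_cycle p"
  let ?h = "?g \<circ> T (?q i) (?q k)"
  note q = word_perm_permutes[OF p]
  note qinj = permutes_inj[OF q]
  have q_eq: "?q a = ?q b \<longleftrightarrow> a = b" for a b using qinj by (auto simp: inj_eq)
  have S: "?q j \<in> ?S" if "j \<le> n" for j using permutes_in_image[OF q, of j] that by simp
  have g: "?g permutes ?S" by (rule long_cycles_permutes[OF word_cycle_long_cycle[OF p]])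
  have h: "?h permutes ?S" using ik by (intro permutes_comp_transpose g S) auto
  have hq: "?h (?q j) = ?q (rotation n (T i k j))" for j
    by (simp add: transpose_image_comp[OF qinj] word_cycle_def permutes_inverses[OF q]
        length_permutations_of_set_upto[OF p])
  have trans: "\<forall>x\<in>?S. \<forall>y\<in>?S. y \<in> orbit ?g x"
    using word_cycle_long_cycle[OF p] g
    by (subst ncycles_eq_1_iff[symmetric]) (auto simp: long_cycles_def lessThan_empty_iff)
  let ?P = "?q ` {i<..k}" and ?R = "?q ` ({..n} - {i<..k})"
  have sep: "?q k \<notin> orbit ?h (?q i)"
    using ik trans S by (intro orbit_split[OF _ g]) (auto simp: q_eq)
  have cover: "orbit ?h (?q i) \<union> orbit ?h (?q k) = ?S"
  proof -
    have "orbit (?h \<circ> T (?q i) (?q k)) (?q i) = orbit ?h (?q i) \<union> orbit ?h (?q k)"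
      using ik S by (intro orbit_merge[OF _ h _ _ sep]) auto
    moreover have "?h \<circ> T (?q i) (?q k) = ?g" by (simp add: comp_assoc)
    moreover have "orbit ?g (?q i) = ?S"
      using trans S[of i] ik permutes_orbit_subset[OF g] by fastforce
    ultimately show ?thesis by simp
  qed
  \<comment> \<open>Each orbit stays within its arc. Since together they cover all points, each
    fills its arc.\<close>
  have P: "orbit ?h (?q k) \<subseteq> ?P"
  proof (rule orbit_subset_closed)
    fix z assume "z \<in> ?P"
    then obtain j where j: "z = ?q j" "i < j" "j \<le> k" by auto
    have "rotation n (T i k j) \<in> {i<..k}"
      using j ik by (auto simp: rotation_def Transposition.transpose_def)
    then show "?h z \<in> ?P" unfolding j hq by blast
  qed (use ik in auto)
  have R: "orbit ?h (?q i) \<subseteq> ?R"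
  proof (rule orbit_subset_closed)
    fix z assume "z \<in> ?R"
    then obtain j where j: "z = ?q j" "j \<le> n" "\<not> (i < j \<and> j \<le> k)" by auto
    have "rotation n (T i k j) \<in> {..n} - {i<..k}"
      using j ik by (auto simp: rotation_def Transposition.transpose_def)
    then show "?h z \<in> ?R" unfolding j hq by blast
  qed (use ik in auto)
  have memP: "?q j \<in> orbit ?h (?q k)" if "i < j" "j \<le> k" for j
  proof -
    have "?q j \<notin> ?R" using that by (auto simp: q_eq)
    then have "?q j \<notin> orbit ?h (?q i)" using R by blast
    moreover have "?q j \<in> ?S" using that ik by (intro S) simp
    ultimately show ?thesis using cover by blast
  qed
  have memR: "?q j \<in> orbit ?h (?q i)" if "j \<le> n" "\<not> (i < j \<and> j \<le> k)" for j
  proof -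
    have "?q j \<notin> ?P" using that by (auto simp: q_eq)
    then have "?q j \<notin> orbit ?h (?q k)" using P by blast
    moreover have "?q j \<in> ?S" using that by (intro S) simp
    ultimately show ?thesis using cover by blast
  qed
  have one: "(i < l \<and> l \<le> k) \<noteq> (i < m \<and> m \<le> k)"
  proof
    assume eq: "(i < l \<and> l \<le> k) = (i < m \<and> m \<le> k)"
    have "orbit ?h (?q l) = orbit ?h (?q m)"
    proof (cases "i < l \<and> l \<le> k")
      case True
      then show ?thesis using memP[of l] memP[of m] eq orbit_eq_of_mem[OF _ h] by (metis finite_lessThan)
    next
      case False
      then show ?thesis using memR[of l] memR[of m] eq lm orbit_eq_of_mem[OF _ h] by (metis finite_lessThan)
    qed
    then show False using nin self_in_orbit[OF _ h, of "?q m"] by simp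
  qed
  \<comment> \<open>Call \<open>a\<close> the endpoint inside the arc \<open>{i<..k}\<close> and
    \<open>b\<close> the one outside.\<close>
  obtain a b where ab: "i < a" "a \<le> k" "b \<le> n" "\<not> (i < b \<and> b \<le> k)" "{a, b} = {l, m}"
    "T (?q l) (?q m) = T (?q a) (?q b)"
  proof (cases "i < l \<and> l \<le> k")
    case True then show ?thesis using that[of l m] one lm by auto
  next
    case False then show ?thesis using that[of m l] one lm by (auto simp: transpose_commute insert_commute)
  qed
  have ne': "\<not> (b = i \<and> a = k)" using ab(5) ne by auto
  \<comment> \<open>In the first two cases the chords appear in crossing order, possibly with
    \<open>a = k\<close> in the first, and disjoint transpositions commute if needed. In the last
    two they share an endpoint, which becomes \<open>i2 = i3\<close>: the blocks are
    adjacent.\<close>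
  consider "k < b" | "b < i" "a < k" | "b = i" "a < k" | "b < i" "a = k"
    using ab ne' by linarith
  then show thesis
  proof cases
    case 1
    then show ?thesis using ab ik by (intro that[of i a k b]) auto
  next
    case 2
    have "T (?q i) (?q k) \<circ> T (?q a) (?q b) = T (?q b) (?q a) \<circ> T (?q i) (?q k)"
      using 2 ab(1,2) ik by (simp add: fun_eq_iff Transposition.transpose_def q_eq)
    then show ?thesis using 2 ab ik by (intro that[of b i a k]) auto
  next
    case 3
    have "T (?q i) (?q k) \<circ> T (?q a) (?q b) = T (?q i) (?q a) \<circ> T (?q a) (?q k)"
      using 3 ab(1,2) ik by (simp add: fun_eq_iff Transposition.transpose_def q_eq)
    then show ?thesis using 3 ab ik by (intro that[of i a a k]) auto
  next
    case 4
    have "T (?q i) (?q k) \<circ> T (?q a) (?q b) = T (?q b) (?q i) \<circ> T (?q i) (?q k)"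
      using 4 ab(1,2) ik by (simp add: fun_eq_iff Transposition.transpose_def q_eq)
    then show ?thesis using 4 ab ik by (intro that[of b i i k]) auto
  qed
qed

text \<open>Two transpositions are chosen that each split a cycle of the breakpoint permutation,
  while on the word cycle the first splits and the second joins again. The latter makes them
  crossing, hence realizable by a block interchange.\<close>

lemma block_interchange_splitting_exists:
  assumes p: "p \<in> permutations_of_set {1..n}" and ne: "breakpoint_perm p \<noteq> id"
  obtains p' where "block_interchange p p'"
    "ncycles {..<Suc n} (breakpoint_perm p') = ncycles {..<Suc n} (breakpoint_perm p) + 2"
proof -
  let ?S = "{..<Suc n}" and ?q = "word_perm p" and ?g = "word_cycle p" and ?t = "breakpoint_perm p"
  note len = length_permutations_of_set_upto[OF p]
  note q = word_perm_permutes[OF p] and t = breakpoint_perm_permutes[OF p]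
  have g: "?g permutes ?S" by (rule long_cycles_permutes[OF word_cycle_long_cycle[OF p]])
  obtain x where x: "?t x \<noteq> x" using ne by (auto simp: fun_eq_iff)
  define y where "y = ?t x"
  have S: "x \<in> ?S" "y \<in> ?S"
    using x permutes_not_in[OF t] permutes_in_image[OF t] unfolding y_def by blast+
  have xy: "x \<noteq> y" using x y_def by simp
  have yt: "y \<in> orbit ?t x" unfolding y_def by (rule orbit.base)
  let ?g1 = "?g \<circ> T x y" and ?t1 = "?t \<circ> T x y"
  have g1: "?g1 permutes ?S" and t1: "?t1 permutes ?S"
    by (rule permutes_comp_transpose(1)[OF g S] permutes_comp_transpose(1)[OF t S])+
  have rg: "rotation n (?t1 u) = ?g1 u" for u
    by (simp add: breakpoint_perm_def len permutes_inverses[OF rotation_permutes])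
  have trans: "\<forall>x\<in>?S. \<forall>y\<in>?S. y \<in> orbit c x" if "c \<in> long_cycles (Suc n)" for c
    using that long_cycles_permutes[OF that]
    by (subst ncycles_eq_1_iff[symmetric]) (auto simp: long_cycles_def lessThan_empty_iff)
  have sep_g: "y \<notin> orbit ?g1 x"
    using trans[OF word_cycle_long_cycle[OF p]] S xy by (intro orbit_split[OF _ g]) auto
  \<comment> \<open>Otherwise the rotation would preserve the two cycles of \<open>?g1\<close>, although it is transitive.\<close>
  have "\<exists>u\<in>?S. ?t1 u \<notin> orbit ?g1 u"
  proof (rule ccontr)
    assume "\<not> (\<exists>u\<in>?S. ?t1 u \<notin> orbit ?g1 u)"
    then have *: "?t1 u \<in> orbit ?g1 u" if "u \<in> ?S" for u using that by blast
    \<comment> \<open>If \<open>v = ?t1 u\<close> shares a cycle of \<open>?g1\<close> with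
      \<open>u\<close>, so does \<open>rotation n v = ?g1 u\<close>.\<close>
    have rot: "rotation n v \<in> orbit ?g1 v" if "v \<in> ?S" for v
    proof -
      have "v \<in> ?t1 ` ?S" unfolding permutes_image[OF t1] by (fact that)
      then obtain u where u: "u \<in> ?S" "v = ?t1 u" by (elim imageE)
      have "orbit ?g1 v = orbit ?g1 u" using orbit_eq_of_mem[OF _ g1 *[OF u(1)]] u by simp
      moreover have "?g1 u \<in> orbit ?g1 u" by (rule orbit.base)
      ultimately show ?thesis using rg[of u] u by simp
    qed
    have "orbit (rotation n) x \<subseteq> orbit ?g1 x"
    proof (rule orbit_subset_closed)
      show "x \<in> orbit ?g1 x" by (rule self_in_orbit[OF _ g1]) simp
      fix z assume z: "z \<in> orbit ?g1 x"
      then have "z \<in> ?S" using permutes_orbit_subset[OF g1 S(1)] by blast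
      then have "rotation n z \<in> orbit ?g1 z" by (rule rot)
      also have "orbit ?g1 z = orbit ?g1 x" by (rule orbit_eq_of_mem[OF _ g1 z]) simp
      finally show "rotation n z \<in> orbit ?g1 x" .
    qed
    then show False using trans[OF rotation_long_cycle] S sep_g by blast
  qed
  then obtain u where u: "u \<in> ?S" "?t1 u \<notin> orbit ?g1 u" by blast
  \<comment> \<open>\<open>T u v\<close> splits a cycle of \<open>?t1\<close> because
    \<open>v\<close> is the image of \<open>u\<close>, and it joins two cycles of \<open>?g1\<close>
    by the choice of \<open>u\<close>.\<close>
  define v where "v = ?t1 u"
  have v: "v \<in> ?S" "v \<notin> orbit ?g1 u" "v \<in> orbit ?t1 u"
    unfolding v_def using u permutes_in_image[OF t1, of u] orbit.base[of ?t1 u]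
    by (simp_all only: not_False_eq_True)
  have uv: "u \<noteq> v" using v(2) self_in_orbit[OF _ g1, of u] by auto
  have n1: "ncycles ?S ?t1 = Suc (ncycles ?S ?t)" by (rule ncycles_split[OF _ t S yt xy]) simp
  have n2: "ncycles ?S (?t1 \<circ> T u v) = Suc (ncycles ?S ?t1)"
    by (rule ncycles_split[OF _ t1 u(1) v(1,3) uv]) simp
  \<comment> \<open>The points \<open>x\<close> and \<open>y\<close> lie on different cycles of
    \<open>?t1\<close> but \<open>u\<close> and \<open>v\<close> on the same one, so the two
    transpositions differ.\<close>
  have sep_t: "y \<notin> orbit ?t1 x" by (rule orbit_split[OF _ t yt xy]) simp
  then have uvxy: "{u, v} \<noteq> {x, y}"
    using v(3) in_orbit_sym[OF _ t1 v(3)] by (auto simp: doubleton_eq_iff)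
  have pos: "\<exists>i\<le>n. s = ?q i" if "s \<in> ?S" for s
  proof -
    have "s \<in> ?q ` ?S" unfolding permutes_image[OF q] by (fact that)
    then show ?thesis by (auto simp: less_Suc_eq_le)
  qed
  obtain i where i: "i \<le> n" "x = ?q i" using pos[OF S(1)] by blast
  obtain k where k: "k \<le> n" "y = ?q k" using pos[OF S(2)] by blast
  obtain l where l: "l \<le> n" "u = ?q l" using pos[OF u(1)] by blast
  obtain m where m: "m \<le> n" "v = ?q m" using pos[OF v(1)] by blast
  have lm_ik: "{l, m} \<noteq> {i, k}" using uvxy i k l m by (auto simp: doubleton_eq_iff)
  obtain i1 i2 i3 i4 where c: "i1 < i2" "i2 \<le> i3" "i3 < i4" "i4 \<le> n"
    "T x y \<circ> T u v = T (?q i1) (?q i3) \<circ> T (?q i2) (?q i4)"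
  proof (cases "i < k")
    case True
    show thesis
      by (rule crossing_transpositions[OF p True k(1) l(1) m(1) _ lm_ik])
        (use v(2) that i k l m in auto)
  next
    case False
    then have ki: "k < i" using xy i k by (metis linorder_less_linear)
    have lm_ki: "{l, m} \<noteq> {k, i}" using lm_ik by (simp add: insert_commute)
    show thesis
      by (rule crossing_transpositions[OF p ki i(1) l(1) m(1) _ lm_ki])
        (use v(2) that i k l m in \<open>auto simp: transpose_commute\<close>)
  qed
  obtain p' where p': "block_interchange p p'" "word_perm p' = ?q \<circ> block_map i1 i2 i3 i4"
    using block_interchange_exists[of i1 i2 i3 i4 p] c len by metis
  have p'_in: "p' \<in> permutations_of_set {1..n}"
    by (rule block_interchange_permutations_of_set[OF p'(1) p])
  have "breakpoint_perm p' = ?t \<circ> (T (?q i1) (?q i3) \<circ> T (?q i2) (?q i4))"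
    unfolding breakpoint_perm_def len length_permutations_of_set_upto[OF p'_in]
      word_cycle_block_map[OF p p'_in c(1-4) p'(2)] by (simp add: comp_assoc)
  also have "\<dots> = ?t1 \<circ> T u v" unfolding c(5)[symmetric] by (simp add: comp_assoc)
  finally have "ncycles ?S (breakpoint_perm p') = ncycles ?S ?t + 2" using n1 n2 by simp
  with p'(1) show thesis by (rule that)
qed

section \<open>The sorting distance and the bijection with long cycles\<close>

lemma word_cycle_inj:
  assumes p: "p \<in> permutations_of_set {1..n}" and p': "p' \<in> permutations_of_set {1..n}"
    and eq: "word_cycle p = word_cycle p'"
  shows "p = p'"
proof (rule nth_equalityI)
  note len = length_permutations_of_set_upto[OF p] length_permutations_of_set_upto[OF p']
  have step: "word_perm r (Suc i) = word_cycle r (word_perm r i)"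
    if "r \<in> permutations_of_set {1..n}" "i < n" for r i
    using that by (simp add: word_cycle_def permutes_inverses[OF word_perm_permutes[OF that(1)]]
        length_permutations_of_set_upto rotation_def)
  \<comment> \<open>A word is read off its cycle by starting at \<open>0\<close> and
    iterating.\<close>
  have same: "word_perm p i = word_perm p' i" if "i \<le> n" for i
    using that by (induction i) (simp_all add: step[OF p] step[OF p'] eq)
  show "length p = length p'" using len by simp
  fix i assume "i < length p"
  then show "p ! i = p' ! i" using same[of "Suc i"] len by (simp add: word_perm_def)
qed

lemma word_perm_upt: "word_perm [1..<Suc n] = id"
proof
  fix i show "word_perm [1..<Suc n] i = id i"
    by (cases i) (auto simp: word_perm_def simp del: upt_Suc One_nat_def)
qed

lemma word_cycle_upt: "word_cycle [1..<Suc n] = rotation n"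
  by (simp add: word_cycle_def word_perm_upt del: upt_Suc One_nat_def)

lemma upt_in_permutations_of_set: "[1..<Suc n] \<in> permutations_of_set {1..n}"
  by (intro permutations_of_setI) auto

lemma breakpoint_perm_upt: "breakpoint_perm [1..<Suc n] = id"
  by (simp add: breakpoint_perm_def word_cycle_upt permutes_inv_o[OF rotation_permutes] del: upt_Suc One_nat_def)

lemma breakpoint_perm_eq_id:
  assumes p: "p \<in> permutations_of_set {1..n}" and "breakpoint_perm p = id"
  shows "p = [1..<Suc n]"
proof (rule word_cycle_inj[OF p upt_in_permutations_of_set])
  have "word_cycle p = rotation n \<circ> breakpoint_perm p"
    by (simp add: breakpoint_perm_def length_permutations_of_set_upto[OF p] fun_eq_iff
        permutes_inverses[OF rotation_permutes])
  then show "word_cycle p = word_cycle [1..<Suc n]" using assms(2) by (simp add: word_cycle_upt del: upt_Suc One_nat_def)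
qed

lemma ncycles_le_card: "finite S \<Longrightarrow> ncycles S p \<le> card S"
  unfolding ncycles_def by (rule card_image_le)

lemma sort_by_block_interchanges:
  assumes "p \<in> permutations_of_set {1..n}"
  shows "\<exists>k. (block_interchange ^^ k) p [1..<Suc n] \<and>
    2 * k + ncycles {..<Suc n} (breakpoint_perm p) = Suc n"
  using assms
proof (induction "Suc n - ncycles {..<Suc n} (breakpoint_perm p)" arbitrary: p rule: less_induct)
  case less
  show ?case
  proof (cases "breakpoint_perm p = id")
    case True
    have "(block_interchange ^^ 0) p [1..<Suc n]"
      using breakpoint_perm_eq_id[OF less.prems True] by simp
    moreover have "2 * 0 + ncycles {..<Suc n} (breakpoint_perm p) = Suc n"
      unfolding True by (simp add: ncycles_id)
    ultimately show ?thesis by blast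
  next
    case False
    obtain p' where p': "block_interchange p p'"
      "ncycles {..<Suc n} (breakpoint_perm p') = ncycles {..<Suc n} (breakpoint_perm p) + 2"
      using block_interchange_splitting_exists[OF less.prems False] by blast
    \<comment> \<open>This bound keeps the truncated subtraction in the induction measure exact, so
      the measure really drops.\<close>
    have "ncycles {..<Suc n} (breakpoint_perm p') \<le> Suc n"
      using ncycles_le_card[of "{..<Suc n}"] by simp
    then have "Suc n - ncycles {..<Suc n} (breakpoint_perm p') <
        Suc n - ncycles {..<Suc n} (breakpoint_perm p)" using p'(2) by linarith
    then obtain k where "(block_interchange ^^ k) p' [1..<Suc n]"
      "2 * k + ncycles {..<Suc n} (breakpoint_perm p') = Suc n"
      using less.hyps[OF _ block_interchange_permutations_of_set[OF p'(1) less.prems]] by blast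
    then show ?thesis
      using relpowp_Suc_I2[of block_interchange, OF p'(1)] p'(2) by (intro exI[of _ "Suc k"]) simp
  qed
qed

text \<open>The sorted word has \<open>n + 1\<close> cycles, and each interchange gains at most
  two.\<close>

lemma block_interchanges_lower_bound:
  assumes "(block_interchange ^^ k) p [1..<Suc n]" "p \<in> permutations_of_set {1..n}"
  shows "Suc n \<le> 2 * k + ncycles {..<Suc n} (breakpoint_perm p)"
  using assms
proof (induction k arbitrary: p)
  case 0
  then have "p = [1..<Suc n]" by simp
  then show ?case by (simp only: breakpoint_perm_upt ncycles_id card_lessThan)
next
  case (Suc k)
  from relpowp_Suc_D2[OF Suc.prems(1)] obtain p' where p':
    "block_interchange p p'" "(block_interchange ^^ k) p' [1..<Suc n]" by blast
  from Suc.IH[OF p'(2) block_interchange_permutations_of_set[OF p'(1) Suc.prems(2)]]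
    ncycles_breakpoint_perm_block_interchange[OF Suc.prems(2) p'(1)]
  show ?case by simp
qed

theorem block_interchanges_to_sort_eq:
  assumes p: "p \<in> permutations_of_set {1..n}"
  shows "2 * block_interchanges_to_sort p + ncycles {..<Suc n} (breakpoint_perm p) = Suc n"
proof -
  obtain k where k: "(block_interchange ^^ k) p [1..<Suc n]"
    "2 * k + ncycles {..<Suc n} (breakpoint_perm p) = Suc n"
    using sort_by_block_interchanges[OF p] by blast
  have "block_interchanges_to_sort p = k"
    unfolding block_interchanges_to_sort_def length_permutations_of_set_upto[OF p]
  proof (rule Least_equality)
    show "(block_interchange ^^ k) p [1..<Suc n]" by (rule k(1))
    fix k' assume "(block_interchange ^^ k') p [1..<Suc n]"
    from block_interchanges_lower_bound[OF this p] show "k \<le> k'" using k(2) by simp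
  qed
  then show ?thesis using k(2) by simp
qed

text \<open>The map is injective and both sets have \<open>n!\<close> elements. Averaging over
  permutations thus becomes averaging over long cycles.\<close>

lemma bij_betw_word_cycle: "bij_betw word_cycle (permutations_of_set {1..n}) (long_cycles (Suc n))"
proof -
  let ?P = "permutations_of_set {1..n}"
  have inj: "inj_on word_cycle ?P" by (intro inj_onI word_cycle_inj)
  have "word_cycle ` ?P = long_cycles (Suc n)"
  proof (rule card_subset_eq)
    show "word_cycle ` ?P \<subseteq> long_cycles (Suc n)" using word_cycle_long_cycle by blast
    show "card (word_cycle ` ?P) = card (long_cycles (Suc n))"
      unfolding card_image[OF inj] by (simp add: card_long_cycles)
  qed simp
  with inj show ?thesis by (simp add: bij_betw_def)
qed

section \<open>The average number of cycles\<close>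

text \<open>Every long cycle is a word cycle, hence conjugate to the rotation; the conjugation is
  absorbed by the sum over \<open>z\<close>.\<close>

lemma sum_ncycles_long_cycle_const:
  assumes "c \<in> long_cycles (Suc n)"
  shows "(\<Sum>z\<in>long_cycles (Suc n). real (ncycles {..<Suc n} (c \<circ> z))) =
    (\<Sum>z\<in>long_cycles (Suc n). real (ncycles {..<Suc n} (rotation n \<circ> z)))"
proof -
  obtain p where p: "p \<in> permutations_of_set {1..n}" "c = word_cycle p"
    using bij_betw_word_cycle[of n] assms by (auto simp: bij_betw_def)
  let ?q = "word_perm p"
  note q = word_perm_permutes[OF p(1)]
  have c: "c = ?q \<circ> rotation n \<circ> inv ?q"
    by (simp add: p word_cycle_def length_permutations_of_set_upto[OF p(1)])
  have "c \<circ> (?q \<circ> z \<circ> inv ?q) = ?q \<circ> (rotation n \<circ> z) \<circ> inv ?q" for z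
    by (simp add: c fun_eq_iff permutes_inverses[OF q])
  then show ?thesis
    using sum_long_cycles_conj[OF q, of "\<lambda>z. real (ncycles {..<Suc n} (c \<circ> z))"]
    by (simp add: ncycles_conj[OF q])
qed

text \<open>The factorization theorem is applied to the cycle count. Inserting a point leaves this
  count alone, so the sum over \<open>a\<close> contributes only a factor \<open>n + 1\<close>, and
  the sum over the first long cycle a factor \<open>n!\<close>.\<close>

lemma sum_ncycles_two_long_cycles:
  assumes c: "c \<in> long_cycles (Suc n)"
  shows "(real n + 1) * (real n + 2) * (\<Sum>z\<in>long_cycles (Suc n). real (ncycles {..<Suc n} (c \<circ> z))) =
    odd_sum (Suc (Suc n)) (\<lambda>s. real (ncycles {..<Suc (Suc n)} s))"
proof -
  let ?N = "Suc n" and ?\<phi> = "\<lambda>s. real (ncycles {..<Suc (Suc n)} s)"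
  define K where "K = (\<Sum>z\<in>long_cycles ?N. real (ncycles {..<?N} (c \<circ> z)))"
  have "factorization_sum ?N ?\<phi> =
      (\<Sum>c\<in>long_cycles ?N. \<Sum>z\<in>long_cycles ?N. \<Sum>a<?N. real (ncycles {..<?N} (c \<circ> z)))"
    unfolding factorization_sum_def
  proof (intro sum.cong refl)
    fix c z a assume "c \<in> long_cycles ?N" "z \<in> long_cycles ?N" "a \<in> {..<?N}"
    then show "?\<phi> (T ?N a \<circ> (c \<circ> z)) = real (ncycles {..<?N} (c \<circ> z))"
      using ncycles_insert_transpose[of "{..<?N}" "c \<circ> z" ?N a]
      by (simp add: lessThan_Suc[of ?N] permutes_compose long_cycles_permutes)
  qed
  also have "\<dots> = real ?N * (\<Sum>c\<in>long_cycles ?N. \<Sum>z\<in>long_cycles ?N. real (ncycles {..<?N} (c \<circ> z)))"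
    by (simp add: sum_distrib_left)
  also have "(\<Sum>c\<in>long_cycles ?N. \<Sum>z\<in>long_cycles ?N. real (ncycles {..<?N} (c \<circ> z))) =
      (\<Sum>c\<in>long_cycles ?N. K)"
    by (rule sum.cong[OF refl], unfold K_def)
      (simp only: sum_ncycles_long_cycle_const sum_ncycles_long_cycle_const[OF c])
  also have "\<dots> = fact n * K" by (simp add: card_long_cycles)
  finally have "factorization_sum ?N ?\<phi> = real ?N * (fact n * K)" .
  moreover have "class_function {..<Suc ?N} ?\<phi>"
    by (simp add: class_function_def ncycles_conj)
  from factorization_sum_eq_odd_sum[OF _ this]
  have "(real ?N + 1) * factorization_sum ?N ?\<phi> = fact n * odd_sum (Suc ?N) ?\<phi>" by simp
  ultimately have "fact n * ((real n + 1) * (real n + 2) * K) = fact n * odd_sum (Suc ?N) ?\<phi>"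
    by (simp add: algebra_simps)
  then show ?thesis unfolding K_def by simp
qed

section \<open>Cycle counts and signs summed over the symmetric group\<close>

lemma ncycles_Suc:
  assumes "s permutes {..<M}"
  shows "ncycles {..<Suc M} s = Suc (ncycles {..<M} s)"
    and "b < M \<Longrightarrow> ncycles {..<Suc M} (T M b \<circ> s) = ncycles {..<M} s"
  using ncycles_insert[OF _ assms, of M] ncycles_insert_transpose[OF _ assms, of M b]
  by (auto simp: lessThan_Suc)

text \<open>A new point is either fixed, adding one cycle, or inserted at one of \<open>M\<close>
  places, adding none.\<close>

lemma sum_ncycles: "(\<Sum>s | s permutes {..<M}. real (ncycles {..<M} s)) = fact M * (\<Sum>i=1..M. 1 / real i)"
proof (induction M)
  case 0
  then show ?case by (simp add: ncycles_def)
next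
  case (Suc M)
  have card: "card {s. s permutes {..<M}} = fact M" by (rule card_permutations) auto
  have "(\<Sum>s | s permutes {..<Suc M}. real (ncycles {..<Suc M} s)) =
      (\<Sum>s | s permutes {..<M}. real (ncycles {..<M} s) + 1) +
      (\<Sum>b<M. \<Sum>s | s permutes {..<M}. real (ncycles {..<M} s))"
    unfolding sum_permutes_Suc
    by (intro arg_cong2[of _ _ _ _ "(+)"] sum.cong refl) (simp_all add: ncycles_Suc)
  then show ?case unfolding sum.distrib Suc.IH by (simp add: card field_simps)
qed

lemma sign_transpose_comp:
  assumes "s permutes {..<M}" "b < M"
  shows "sign (T M b \<circ> s) = - sign s"
  using assms permutes_imp_permutation[OF _ assms(1)]
  by (simp add: sign_compose permutation_swap_id sign_swap_id)

lemma sum_sign_Suc: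
  "(\<Sum>s | s permutes {..<Suc M}. real_of_int (sign s)) =
    (1 - real M) * (\<Sum>s | s permutes {..<M}. real_of_int (sign s))"
proof -
  have "(\<Sum>s | s permutes {..<Suc M}. real_of_int (sign s)) =
      (\<Sum>s | s permutes {..<M}. real_of_int (sign s)) +
      (\<Sum>b<M. \<Sum>s | s permutes {..<M}. - real_of_int (sign s))"
    unfolding sum_permutes_Suc
    by (intro arg_cong2[of _ _ _ _ "(+)"] sum.cong refl) (simp_all add: sign_transpose_comp)
  then show ?thesis by (simp add: sum_negf algebra_simps)
qed

lemma sum_sign_ncycles_Suc:
  "(\<Sum>s | s permutes {..<Suc M}. real_of_int (sign s) * real (ncycles {..<Suc M} s)) =
    (1 - real M) * (\<Sum>s | s permutes {..<M}. real_of_int (sign s) * real (ncycles {..<M} s)) +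
    (\<Sum>s | s permutes {..<M}. real_of_int (sign s))"
proof -
  have "(\<Sum>s | s permutes {..<Suc M}. real_of_int (sign s) * real (ncycles {..<Suc M} s)) =
      (\<Sum>s | s permutes {..<M}. real_of_int (sign s) * real (ncycles {..<M} s) + real_of_int (sign s)) +
      (\<Sum>b<M. \<Sum>s | s permutes {..<M}. - (real_of_int (sign s) * real (ncycles {..<M} s)))"
    unfolding sum_permutes_Suc
    by (intro arg_cong2[of _ _ _ _ "(+)"] sum.cong refl)
      (simp_all add: sign_transpose_comp ncycles_Suc algebra_simps)
  then show ?thesis by (simp add: sum_negf sum.distrib algebra_simps)
qed

lemma sum_sign_eq_0: "(\<Sum>s | s permutes {..<Suc (Suc n)}. real_of_int (sign s)) = 0"
proof (induction n)
  case 0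
  show ?case by (simp add: sum_sign_Suc)
next
  case (Suc n)
  show ?case by (subst sum_sign_Suc) (simp only: Suc.IH mult_zero_right)
qed

text \<open>From two points on the plain sign sum vanishes, so each further point only multiplies by
  \<open>1 - M\<close>. The starting value 1 is the sign sum over one point.\<close>

lemma sum_sign_ncycles:
  "(\<Sum>s | s permutes {..<Suc (Suc n)}. real_of_int (sign s) * real (ncycles {..<Suc (Suc n)} s)) =
    (- 1) ^ n * fact n"
proof (induction n)
  case 0
  show ?case by (simp add: sum_sign_ncycles_Suc sum_sign_Suc)
next
  case (Suc n)
  show ?case
    by (subst sum_sign_ncycles_Suc) (simp only: Suc.IH sum_sign_eq_0, simp add: algebra_simps)
qed

lemma odd_sum_ncycles:
  "odd_sum (Suc (Suc n)) (\<lambda>s. real (ncycles {..<Suc (Suc n)} s)) =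
    fact (Suc (Suc n)) * (\<Sum>i=1..Suc (Suc n). 1 / real i) - (- 1) ^ n * fact n"
  unfolding odd_sum_def sum_ncycles[symmetric] sum_sign_ncycles[symmetric]
  by (simp only: left_diff_distrib sum_subtractf mult_1)

lemma sum_ncycles_breakpoint_perm:
  "(\<Sum>p\<in>permutations_of_set {1..n}. real (ncycles {..<Suc n} (breakpoint_perm p))) =
    fact n * ((\<Sum>i=1..Suc (Suc n). 1 / real i) - (- 1) ^ n / ((real n + 1) * (real n + 2)))"
    (is "?L = fact n * (?H - _)")
proof -
  have "?L = (\<Sum>p\<in>permutations_of_set {1..n}.
      real (ncycles {..<Suc n} (inv (rotation n) \<circ> word_cycle p)))"
    by (intro sum.cong refl) (simp add: breakpoint_perm_def length_permutations_of_set_upto)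
  also have "\<dots> = (\<Sum>z\<in>long_cycles (Suc n). real (ncycles {..<Suc n} (inv (rotation n) \<circ> z)))"
    by (rule sum.reindex_bij_betw[OF bij_betw_word_cycle])
  finally have "(real n + 1) * (real n + 2) * ?L = fact (Suc (Suc n)) * ?H - (- 1) ^ n * fact n"
    using sum_ncycles_two_long_cycles[OF long_cycles_inv[OF rotation_long_cycle]]
    unfolding odd_sum_ncycles by simp
  also have "\<dots> = (real n + 1) * (real n + 2) *
      (fact n * (?H - (- 1) ^ n / ((real n + 1) * (real n + 2))))"
  proof -
    have "fact (Suc (Suc n)) = (real n + 1) * (real n + 2) * fact n" by (simp add: algebra_simps)
    moreover have "(real n + 1) * (real n + 2) * (fact n * (h - e / ((real n + 1) * (real n + 2)))) =
        (real n + 1) * (real n + 2) * fact n * h - e * fact n" for h e :: real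
    proof -
      have "(real n + 1) * (real n + 2) \<noteq> 0" by simp
      then show ?thesis by (simp add: right_diff_distrib)
    qed
    ultimately show ?thesis by simp
  qed
  finally show ?thesis by simp
qed

text \<open>The left side is \<open>2 / (n + 2)\<close> for even \<open>n\<close> and
  \<open>2 / (n + 1)\<close> for odd \<open>n\<close>; the alternating term selects between
  them.\<close>

lemma inverse_half_floor:
  "1 / (of_int \<lfloor>real n / 2\<rfloor> + 1) =
    1 / (real n + 1) + 1 / (real n + 2) - (- 1) ^ n / ((real n + 1) * (real n + 2))"
proof -
  have floor: "\<lfloor>real n / 2\<rfloor> = int (n div 2)"
    using floor_divide_of_nat_eq[of n 2] by simp
  show ?thesis
  proof (cases "even n")
    case True
    then obtain m where "n = 2 * m" by blast
    then show ?thesis unfolding floor by (simp add: divide_simps) (simp add: algebra_simps)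
  next
    case False
    then obtain m where "n = 2 * m + 1" by (elim oddE)
    then show ?thesis unfolding floor by (simp add: divide_simps) (simp add: algebra_simps)
  qed
qed

theorem theorem5:
  fixes n :: nat
  assumes "n \<ge> 1"
  shows "(\<Sum>p\<in>permutations_of_set {1..n}. real (block_interchanges_to_sort p)) / fact n =
    1 / 2 * (real n - 1 / (of_int \<lfloor>real n / 2\<rfloor> + 1) - (\<Sum>i = 2..n. 1 / real i))"
proof -
  let ?P = "permutations_of_set {1..n}"
  define e where "e = (- 1) ^ n / ((real n + 1) * (real n + 2))"
  define H where "H = (\<Sum>i = 2..n. 1 / real i)"
  have "real (block_interchanges_to_sort p) =
      1 / 2 * (real (Suc n) - real (ncycles {..<Suc n} (breakpoint_perm p)))" if "p \<in> ?P" for p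
    using arg_cong[OF block_interchanges_to_sort_eq[OF that], of real] by simp
  then have "(\<Sum>p\<in>?P. real (block_interchanges_to_sort p)) =
      (\<Sum>p\<in>?P. 1 / 2 * (real (Suc n) - real (ncycles {..<Suc n} (breakpoint_perm p))))"
    by (intro sum.cong refl)
  also have "\<dots> = 1 / 2 * (fact n * real (Suc n) -
      (\<Sum>p\<in>?P. real (ncycles {..<Suc n} (breakpoint_perm p))))"
    by (simp only: sum_distrib_left[symmetric] sum_subtractf) simp
  also have "\<dots> = fact n * (1 / 2 * (real (Suc n) - ((\<Sum>i=1..Suc (Suc n). 1 / real i) - e)))"
    unfolding sum_ncycles_breakpoint_perm e_def by (simp only: right_diff_distrib)
  also have "(\<Sum>i=1..Suc (Suc n). 1 / real i) = 1 + H + 1 / (real n + 1) + 1 / (real n + 2)"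
  proof -
    have "(\<Sum>i=1..n. 1 / real i) = 1 + H"
      unfolding H_def using sum.atLeast_Suc_atMost[of 1 n "\<lambda>i. 1 / real i"] assms
      by (simp add: numeral_2_eq_2)
    then show ?thesis by (simp add: add_ac)
  qed
  finally have "(\<Sum>p\<in>?P. real (block_interchanges_to_sort p)) / fact n =
      1 / 2 * (real (Suc n) - (1 + H + 1 / (real n + 1) + 1 / (real n + 2) - e))"
    by simp
  \<comment> \<open>The leading 1 of the harmonic sum lowers \<open>n + 1\<close> to
    \<open>n\<close>, and the last two terms join \<open>e\<close> to form the floor
    expression.\<close>
  also have "\<dots> = 1 / 2 * (real n - (1 / (real n + 1) + 1 / (real n + 2) - e) - H)" by simp
  finally show ?thesis unfolding inverse_half_floor H_def e_def .
qed

end
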